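(* The map $\lambda\mapsto\beta(\lambda)$ is (strictly) increasing and continuous from $(0,2)$ onto $(1,\infty)$.
   Context: Definition of $\beta(\lambda)$: for each $\lambda\in(0,2)$, $\beta(\lambda)$ is the unique $\beta>1$ for which there is a homeomorphism $\phi_\lambda:[0,\infty)\to[0,1)$ with $\phi_\lambda\circ T_\lambda=S_\beta\circ\phi_\lambda$; equivalently, the unique $\beta>1$ such that $\mathcal{O}_\beta(1)=\omega_\lambda(\infty)$. The objects involved are as follows. Fix a real number $0<\lambda<2$. Let $h(y)=\frac{1}{\lambda-y}$ and $h_0(y)=\frac{y}{\lambda y+1}$. Define $m_0^\lambda=0$ and, as long as $m_i^\lambda<\lambda$, $m_{i+1}^\lambda=h(m_i^\lambda)$ (so $m_1^\lambda=1/\lambda$). This sequence is increasing and finite: there is an integer $i_\lambda\ge 1$ with $0=m_0^\lambda<m_1^\lambda<\cdots<m_{i_\lambda-1}^\lambda<\lambda\le m_{i_\lambda}^\lambda<\infty$. For $0\le i<i_\lambda$ set $h_{i+1}=h\circ h_i$. Let $I_i^\lambda=[m_i^\lambda,m_{i+1}^\lambda)$ for $0\le i<i_\lambda$ and $I_{i_\lambda}^\lambda=[m_{i_\lambda}^\lambda,\infty)$; these intervals partition $[0,\infty)$. For $i<i_\lambda$, $h_i$ is an increasing bijection from $[0,\infty)$ onto $I_i^\lambda$; $h_{i_\lambda}$ is an increasing bijection from $[0,\ell_\lambda)$ onto $I_{i_\lambda}^\lambda$, where $\ell_\lambda=h_{i_\lambda-1}^{-1}(\lambda)$ if $m_{i_\lambda}^\lambda>\lambda$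 and $\ell_\lambda=\infty$ if $m_{i_\lambda}^\lambda=\lambda$. The map $T_\lambda:[0,\infty)\to[0,\infty)$ is defined by $T_\lambda(x)=h_i^{-1}(x)$ for $x\in I_i^\lambda$. Coding: for $x\in[0,\infty)$, $\omega_\lambda(x)=x_0x_1x_2\ldots$, with $x_n\in\{0,\ldots,i_\lambda\}$ the unique index such that $T_\lambda^n(x)\in I_{x_n}^\lambda$. The map $x\mapsto\omega_\lambda(x)$ is non-decreasing for the lexicographic order, and $\omega_\lambda(\infty)$ denotes its limit as $x\to\infty$ (for each $n$, its prefix of length $n+1$ is the common prefix of length $n+1$ of $\omega_\lambda(x)$ for all sufficiently large real $x$). For $\beta>1$, $S_\beta:[0,1)\to[0,1)$, $S_\beta(t)=\beta t\bmod 1$; for $t\in[0,1)$, $\mathcal{O}_\beta(t)=(t_n)_{n\ge0}$ with $t_n=\lfloor\beta S_\beta^n(t)\rfloor$ (ordinary integer part); and $\mathcal{O}_\beta(1)$ is the (lexicographically increasing, termwise) limit of $\mathcal{O}_\beta(t)$ as $t\uparrow1$. *)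

theory Defs
  imports "HOL-Analysis.Analysis"
begin

definition h_map :: "real \<Rightarrow> real \<Rightarrow> real" where
  "h_map lam y = 1 / (lam - y)"

definition h_zero :: "real \<Rightarrow> real \<Rightarrow> real" where
  "h_zero lam y = y / (lam * y + 1)"

(* Total in i, but only the terms up to the first one that is at least lam are meaningful and
   used; division by zero may occur beyond it. *)
primrec m_pt :: "real \<Rightarrow> nat \<Rightarrow> real" where
  "m_pt lam 0 = 0"
| "m_pt lam (Suc i) = h_map lam (m_pt lam i)"

definition i_top :: "real \<Rightarrow> nat" where
  "i_top lam = (LEAST i. lam \<le> m_pt lam i)"

(* Likewise only used for i up to i_top lam. *)
primrec h_branch :: "real \<Rightarrow> nat \<Rightarrow> real \<Rightarrow> real" where
  "h_branch lam 0 = h_zero lam"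
| "h_branch lam (Suc i) = h_map lam \<circ> h_branch lam i"

definition I_part :: "real \<Rightarrow> nat \<Rightarrow> real set" where
  "I_part lam i = (if i < i_top lam then {m_pt lam i..<m_pt lam (Suc i)} else {m_pt lam i..})"

(* The domain [0, l) of the last branch, where l may be infinite. *)
definition last_domain :: "real \<Rightarrow> real set" where
  "last_domain lam =
     (if m_pt lam (i_top lam) > lam
      then {0..<inv_into {0..} (h_branch lam (i_top lam - 1)) lam}
      else {0..})"

definition branch_domain :: "real \<Rightarrow> nat \<Rightarrow> real set" where
  "branch_domain lam i = (if i < i_top lam then {0..} else last_domain lam)"

definition part_index :: "real \<Rightarrow> real \<Rightarrow> nat" where
  "part_index lam x = (THE i. i \<le> i_top lam \<and> x \<in> I_part lam i)"

definition T_map :: "real \<Rightarrow> real \<Rightarrow> real" where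
  "T_map lam x = inv_into (branch_domain lam (part_index lam x)) (h_branch lam (part_index lam x)) x"

definition S_map :: "real \<Rightarrow> real \<Rightarrow> real" where
  "S_map \<beta> t = frac (\<beta> * t)"

definition conjugate_T_S :: "real \<Rightarrow> real \<Rightarrow> bool" where
  "conjugate_T_S lam \<beta> \<longleftrightarrow>
     (\<exists>\<phi> \<psi>. homeomorphism {0..} {0..<1} \<phi> \<psi> \<and> (\<forall>x\<in>{0..}. \<phi> (T_map lam x) = S_map \<beta> (\<phi> x)))"

definition beta :: "real \<Rightarrow> real" where
  "beta lam = (THE \<beta>. 1 < \<beta> \<and> conjugate_T_S lam \<beta>)"

end

theory Submission imports Defs begin

text \<open>Write \<open>lam = 2 cos \<theta>\<close> with \<open>0 < \<theta> < pi / 2\<close>. The map \<open>h_map lam\<close> is an elliptic Moebius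
transformation, a rotation by \<open>\<theta>\<close> in an angular coordinate. Measuring this angle in units of \<open>\<theta>\<close>
gives a coordinate \<open>v\<close> on \<open>[0, N)\<close> with \<open>N = pi / \<theta> - 1\<close>, in which \<open>h_map lam\<close> is \<open>v + 1\<close>, the
breakpoints are the integers, and \<open>T_map lam\<close> becomes \<open>v \<mapsto> G (frac v)\<close> for a single increasing
branch \<open>G\<close> from \<open>[0, 1]\<close> onto \<open>[0, N]\<close>, determined by \<open>cot (\<theta> G u) = cot (\<theta> u) - 2 cot \<theta>\<close>
(\<open>T_map_coord\<close>). Two properties of \<open>G\<close> carry everything: it increases distances
(\<open>expanding_angle_branch\<close>), and for fixed \<open>u\<close> the value \<open>G u\<close> grows with \<open>lam\<close>, at a controlled rate
(\<open>angle_branch_compare\<close>).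

For a map \<open>\<tau> v = G (frac v)\<close> of this kind and a base \<open>b > 1\<close>, a conjugacy to the
\<open>b\<close>-transformation can only be the series of the digits \<open>floor (\<tau>^n v)\<close> divided by \<open>b^(n + 1)\<close>,
and this series is a conjugacy exactly if its supremum is \<open>1\<close> (\<open>conjugate_iff\<close>). Expansion separates
orbits and makes the series strictly increasing; a jump would be magnified by the factor \<open>b\<close> at
each step, so the series is continuous. The supremum, multiplied by \<open>b\<close>, is non-increasing in \<open>b\<close>,
and it takes the value \<open>1\<close> for exactly one base.

The conjugacy for a larger parameter dominates the digit series, in the same base, for a smaller one.
On the smaller domain it stays away from \<open>1\<close>; this makes the base strictly increasing
(\<open>sup_1_strict_mono\<close>). If two branches are uniformly close, the conjugacy of the first almost
solves the self-similar equation of the second, so that the supremum of the second series in the base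
of the first is close to \<open>1\<close>; this makes the base continuous (\<open>sup_1_stable\<close>). Finally the base
exceeds every integer in the domain, and it tends to \<open>1\<close> as \<open>lam\<close> tends to \<open>0\<close> because the branch
tends to the identity on \<open>[0, 1)\<close> while \<open>N\<close> tends to \<open>1\<close>.\<close>

section \<open>Contraction bounds and monotone bijections\<close>

text \<open>The supremum \<open>M\<close> of \<open>f\<close> satisfies \<open>M \<le> c + q M\<close>. The self-similar equation of a digit
series has this shape with \<open>q = 1 / b\<close>, so that comparisons of such series, between points, bases
or dynamical systems, can all be made without looking at digit sequences.\<close>

lemma contraction_upper_bound:
  fixes f :: "'a \<Rightarrow> real"
  assumes q: "0 \<le> q" "q < 1"
    and bdd: "bdd_above (f ` A)"
    and step: "\<And>a. a \<in> A \<Longrightarrow> \<exists>b\<in>A. f a \<le> c + q * f b"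
    and a: "a \<in> A"
  shows "f a \<le> c / (1 - q)"
proof -
  define M where "M = (SUP a\<in>A. f a)"
  have "f b \<le> M" if "b \<in> A" for b
    unfolding M_def using that bdd by (rule cSUP_upper)
  then have "f b \<le> c + q * M" if "b \<in> A" for b
    using step[OF that] q(1) by (meson add_left_mono mult_left_mono order_trans)
  then have "M \<le> c + q * M"
    unfolding M_def using a by (intro cSUP_least) auto
  then have "M * (1 - q) \<le> c" by (simp add: algebra_simps)
  then have "M \<le> c / (1 - q)" using q by (simp add: pos_le_divide_eq)
  then show ?thesis using \<open>\<And>b. b \<in> A \<Longrightarrow> f b \<le> M\<close>[OF a] by linarith
qed

text \<open>A jump of a monotone function would leave out values. The criterion \<open>continuous_onI_mono\<close>
asks for an open image; continuing \<open>f\<close> by a line of slope one to the left of \<open>a\<close> provides it.\<close>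

lemma mono_onto_imp_continuous_on:
  fixes f :: "real \<Rightarrow> real"
  assumes mono: "mono_on {a..<b} f" and onto: "f ` {a..<b} = {c..<d}" and ab: "a < b"
  shows "continuous_on {a..<b} f"
proof -
  define g where "g x = (if x < a then c + (x - a) else f x)" for x
  have fc: "c \<le> f x" "f x < d" if "a \<le> x" "x < b" for x
    using onto that by auto
  have cd: "c < d" using fc[of a] ab by linarith
  have "g ` {..<b} = {..<d}"
  proof (intro equalityI subsetI)
    fix y assume "y \<in> g ` {..<b}"
    then show "y \<in> {..<d}" using fc cd by (auto simp: g_def)
  next
    fix y assume y: "y \<in> {..<d}"
    show "y \<in> g ` {..<b}"
    proof (cases "y < c")
      case True
      then have "y = g (a + (y - c))" "a + (y - c) < b" using ab by (auto simp: g_def)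
      then show ?thesis by blast
    next
      case False
      then have "y \<in> f ` {a..<b}" using y onto by auto
      then obtain x where "a \<le> x" "x < b" "y = f x" by auto
      then have "y = g x" "x < b" by (auto simp: g_def)
      then show ?thesis by blast
    qed
  qed
  moreover have "g x \<le> g y" if "x \<in> {..<b}" "y \<in> {..<b}" "x \<le> y" for x y
    using that fc[of y] mono_onD[OF mono, of x y] by (auto simp: g_def)
  ultimately have "continuous_on {..<b} g"
    by (intro continuous_onI_mono) auto
  then have "continuous_on {a..<b} g" by (rule continuous_on_subset) auto
  then show ?thesis by (rule continuous_on_eq) (auto simp: g_def)
qed

lemma strict_mono_onto_imp_homeomorphism:
  fixes f :: "real \<Rightarrow> real"
  assumes mono: "strict_mono_on {a..<b} f" and onto: "f ` {a..<b} = {c..<d}" and ab: "a < b"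
  shows "\<exists>g. homeomorphism {a..<b} {c..<d} f g"
proof (rule homeomorphism_into_1d)
  show "continuous_on {a..<b} f"
    using strict_mono_on_imp_mono_on[OF mono] onto ab by (rule mono_onto_imp_continuous_on)
  show "path_connected {a..<b}" by (simp add: convex_imp_path_connected)
  show "inj_on f {a..<b}" using mono by (rule strict_mono_on_imp_inj_on)
qed (rule onto)

lemma geometric_tail_sums:
  assumes "1 < (b::real)"
  shows "(\<lambda>n. c / b ^ Suc n) sums (c / (b - 1))"
proof -
  have "(\<lambda>n. (1/b) ^ n) sums (1 / (1 - 1/b))"
    using assms by (intro geometric_sums) auto
  then have "(\<lambda>n. c / b * (1/b) ^ n) sums (c / b * (1 / (1 - 1/b)))" by (rule sums_mult)
  moreover have "c / b * (1 / (1 - 1/b)) = c / (b - 1)" using assms by (simp add: field_simps)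
  moreover have "(\<lambda>n. c / b * (1/b) ^ n) = (\<lambda>n. c / b ^ Suc n)" by (simp add: power_divide)
  ultimately show ?thesis by metis
qed

section \<open>Conjugacy of an expanding floor map to a beta-transformation\<close>

definition floor_map :: "(real \<Rightarrow> real) \<Rightarrow> real \<Rightarrow> real" where
  "floor_map G v = G (frac v)"

definition digit_series :: "(real \<Rightarrow> real) \<Rightarrow> real \<Rightarrow> real \<Rightarrow> real" where
  "digit_series G b v = (\<Sum>n. of_int \<lfloor>(floor_map G ^^ n) v\<rfloor> / b ^ Suc n)"

text \<open>The condition \<open>digit_sup G b = 1\<close> is the analytic form of the condition that the expansion of \<open>1\<close> in
base \<open>b\<close> is the limit of the digit sequences at the right end of the domain.\<close>

definition digit_sup :: "(real \<Rightarrow> real) \<Rightarrow> real \<Rightarrow> real" where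
  "digit_sup G b = (SUP v\<in>{0..<G 1}. digit_series G b v)"

definition conjugate_floor_map :: "(real \<Rightarrow> real) \<Rightarrow> real \<Rightarrow> bool" where
  "conjugate_floor_map G b \<longleftrightarrow>
     (\<exists>\<phi> \<psi>. homeomorphism {0..<G 1} {0..<1} \<phi> \<psi> \<and>
            (\<forall>v\<in>{0..<G 1}. \<phi> (floor_map G v) = S_map b (\<phi> v)))"

text \<open>The floor map of \<open>G\<close> acts on \<open>{0..<G 1}\<close>; it applies the same increasing branch after the integer
part has been removed. The monotonicity of \<open>G u - u\<close> says that \<open>G\<close> increases distances. A
uniform expansion factor would be too much to ask for: the branches that come from \<open>T_map\<close> have
slope one at both ends.\<close>

locale expanding_branch =
  fixes G :: "real \<Rightarrow> real"
  assumes G_0 [simp]: "G 0 = 0"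
    and G_cont: "continuous_on {0..1} G"
    and G_excess: "strict_mono_on {0..1} (\<lambda>u. G u - u)"
begin

abbreviation "\<tau> \<equiv> floor_map G"

lemma G_expands: "0 \<le> x \<Longrightarrow> x < y \<Longrightarrow> y \<le> 1 \<Longrightarrow> y - x < G y - G x"
  using strict_mono_onD[OF G_excess, of x y] by auto

lemma G_less: "0 \<le> x \<Longrightarrow> x < y \<Longrightarrow> y \<le> 1 \<Longrightarrow> G x < G y"
  using G_expands[of x y] by auto

lemma G_le: "0 \<le> x \<Longrightarrow> x \<le> y \<Longrightarrow> y \<le> 1 \<Longrightarrow> G x \<le> G y"
  using G_less[of x y] by (cases "x = y") auto

lemma G1_gt_1: "1 < G 1" using G_expands[of 0 1] by simp

lemma G_bounds: "0 \<le> u \<Longrightarrow> u < 1 \<Longrightarrow> 0 \<le> G u \<and> G u < G 1"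
  using G_le[of 0 u] G_less[of u 1] by auto

lemma G_surj:
  assumes "0 \<le> w" "w < G 1"
  obtains u where "0 \<le> u" "u < 1" "G u = w"
proof -
  obtain u where u: "0 \<le> u" "u \<le> 1" "G u = w"
    using IVT'[of G 0 w 1] assms G_cont by auto
  with assms have "u \<noteq> 1" by auto
  with u that show ?thesis by auto
qed

lemma tau_range: "0 \<le> \<tau> v" "\<tau> v < G 1"
  using G_bounds[of "frac v"] frac_lt_1[of v] by (auto simp: floor_map_def)

lemma tau_in: "\<tau> v \<in> {0..<G 1}" using tau_range by auto

lemma tau_iter_in: "v \<in> {0..<G 1} \<Longrightarrow> (\<tau> ^^ n) v \<in> {0..<G 1}"
  by (cases n) (use tau_in in auto)

lemma tau_int_add: "0 \<le> u \<Longrightarrow> u < 1 \<Longrightarrow> \<tau> (of_int k + u) = G u"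
proof -
  assume "0 \<le> u" "u < 1"
  then have "\<lfloor>of_int k + u\<rfloor> = k" by (intro floor_unique) auto
  then show ?thesis by (simp add: floor_map_def frac_def)
qed

lemma tau_floor_eq: "\<tau> v = G (v - of_int \<lfloor>v\<rfloor>)"
  by (simp add: floor_map_def frac_def)

lemma tau_less: "x < y \<Longrightarrow> \<lfloor>x\<rfloor> = \<lfloor>y\<rfloor> \<Longrightarrow> \<tau> x < \<tau> y"
  using frac_lt_1[of y] frac_ge_0[of x] G_less[of "frac x" "frac y"]
  by (simp add: floor_map_def frac_def del: frac_ge_0)

lemma tau_le: "x \<le> y \<Longrightarrow> \<lfloor>x\<rfloor> = \<lfloor>y\<rfloor> \<Longrightarrow> \<tau> x \<le> \<tau> y"
  using tau_less[of x y] by (cases "x = y") auto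

lemma tau_eq_0_iff: "\<tau> v = 0 \<longleftrightarrow> v \<in> \<int>"
proof -
  have "\<tau> v = 0 \<longleftrightarrow> frac v = 0"
    unfolding floor_map_def using G_less[of 0 "frac v"] frac_lt_1[of v] frac_ge_0[of v] G_0
    by (metis less_eq_real_def order_less_irrefl)
  then show ?thesis by simp
qed

text \<open>Distances of size at least \<open>L\<close> grow by a fixed amount, because the growth is a positive continuous
function of the position on a compact interval.\<close>

lemma uniform_excess:
  assumes "0 < L"
  obtains d where "0 < d"
    and "\<And>x y. 0 \<le> x \<Longrightarrow> x + L \<le> y \<Longrightarrow> y \<le> 1 \<Longrightarrow> y - x + d \<le> G y - G x"
proof (cases "L \<le> 1")
  case False
  then show ?thesis using that[of 1] by auto
next
  case True
  let ?e = "\<lambda>x. (G (x + L) - (x + L)) - (G x - x)"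
  have "continuous_on {0..1-L} ?e"
    using assms by (intro continuous_intros continuous_on_compose2[OF G_cont]
        continuous_on_subset[OF G_cont]) auto
  moreover have "{0..1-L} \<noteq> {}" using True by auto
  ultimately obtain x0 where x0: "x0 \<in> {0..1-L}" "\<And>x. x \<in> {0..1-L} \<Longrightarrow> ?e x0 \<le> ?e x"
    using continuous_attains_inf[of "{0..1-L}" ?e] by auto
  show ?thesis
  proof (rule that)
    show "0 < ?e x0" using G_expands[of x0 "x0 + L"] x0(1) assms by auto
    fix x y assume xy: "0 \<le> x" "x + L \<le> y" "y \<le> (1::real)"
    have "G (x + L) - (x + L) \<le> G y - y"
      using G_expands[of "x+L" y] xy assms by (cases "x + L = y") auto
    with x0(2)[of x] xy show "y - x + ?e x0 \<le> G y - G x" by auto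
  qed
qed

text \<open>Two orbits with equal digits drift apart linearly by \<open>uniform_excess\<close>, which is impossible in a
bounded interval. So distinct points have distinct digit sequences.\<close>

lemma orbits_separate:
  assumes xy: "0 \<le> x" "x < y" "y < G 1"
  obtains n where "\<And>j. j < n \<Longrightarrow> \<lfloor>(\<tau> ^^ j) x\<rfloor> = \<lfloor>(\<tau> ^^ j) y\<rfloor>"
    and "(\<tau> ^^ n) x < (\<tau> ^^ n) y" and "\<lfloor>(\<tau> ^^ n) x\<rfloor> < \<lfloor>(\<tau> ^^ n) y\<rfloor>"
proof -
  define L where "L = y - x"
  obtain d where d: "0 < d"
    "\<And>x y. 0 \<le> x \<Longrightarrow> x + L \<le> y \<Longrightarrow> y \<le> 1 \<Longrightarrow> y - x + d \<le> G y - G x"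
    using uniform_excess[of L] xy L_def by auto
  have grow: "L + real n * d \<le> (\<tau> ^^ n) y - (\<tau> ^^ n) x"
    if "\<And>j. j < n \<Longrightarrow> \<lfloor>(\<tau> ^^ j) x\<rfloor> = \<lfloor>(\<tau> ^^ j) y\<rfloor>" for n
    using that
  proof (induction n)
    case (Suc n)
    let ?x = "(\<tau> ^^ n) x" and ?y = "(\<tau> ^^ n) y"
    have IH: "L + real n * d \<le> ?y - ?x" using Suc by auto
    have fl: "\<lfloor>?x\<rfloor> = \<lfloor>?y\<rfloor>" using Suc by auto
    have *: "frac ?y - frac ?x = ?y - ?x" using fl by (simp add: frac_def)
    have "0 \<le> real n * d" using d by auto
    then have "frac ?x + L \<le> frac ?y" using * IH by linarith
    then have "frac ?y - frac ?x + d \<le> \<tau> ?y - \<tau> ?x"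
      using frac_lt_1[of ?y] d(2)[of "frac ?x" "frac ?y"] by (simp add: floor_map_def[of G ?x] floor_map_def[of G ?y])
    then show ?case using IH * by (simp add: algebra_simps)
  qed (simp add: L_def)
  have "\<exists>n. \<lfloor>(\<tau> ^^ n) x\<rfloor> \<noteq> \<lfloor>(\<tau> ^^ n) y\<rfloor>"
  proof (rule ccontr)
    assume "\<not> ?thesis"
    then have g: "L + real n * d \<le> (\<tau> ^^ n) y - (\<tau> ^^ n) x" for n using grow by auto
    obtain n where "G 1 < real n * d" using d(1) reals_Archimedean3 by blast
    moreover have "(\<tau> ^^ n) y - (\<tau> ^^ n) x \<le> G 1"
      using tau_iter_in[of x n] tau_iter_in[of y n] xy by auto
    ultimately show False using g[of n] xy L_def by auto
  qed
  then obtain n where n: "\<lfloor>(\<tau> ^^ n) x\<rfloor> \<noteq> \<lfloor>(\<tau> ^^ n) y\<rfloor>"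
    and least: "\<And>j. j < n \<Longrightarrow> \<lfloor>(\<tau> ^^ j) x\<rfloor> = \<lfloor>(\<tau> ^^ j) y\<rfloor>"
    using exists_least_iff[of "\<lambda>n. \<lfloor>(\<tau> ^^ n) x\<rfloor> \<noteq> \<lfloor>(\<tau> ^^ n) y\<rfloor>"] by auto
  have "0 \<le> real n * d" using d by auto
  then have less: "(\<tau> ^^ n) x < (\<tau> ^^ n) y" using grow[of n, OF least] xy L_def by linarith
  then have "\<lfloor>(\<tau> ^^ n) x\<rfloor> \<le> \<lfloor>(\<tau> ^^ n) y\<rfloor>" by (intro floor_mono) auto
  with n least less show ?thesis by (intro that) auto
qed

lemma digit_nonneg: "v \<in> {0..<G 1} \<Longrightarrow> 0 \<le> (of_int \<lfloor>(\<tau> ^^ n) v\<rfloor> :: real)"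
  using tau_iter_in[of v n] by simp

lemma digit_less: "v \<in> {0..<G 1} \<Longrightarrow> (of_int \<lfloor>(\<tau> ^^ n) v\<rfloor> :: real) < G 1"
  using tau_iter_in[of v n] of_int_floor_le[of "(\<tau> ^^ n) v"]
  by (meson atLeastLessThan_iff le_less_trans)

lemma digit_summable:
  assumes "1 < b" "v \<in> {0..<G 1}"
  shows "summable (\<lambda>n. of_int \<lfloor>(\<tau> ^^ n) v\<rfloor> / b ^ Suc n :: real)"
proof (rule summable_comparison_test)
  show "summable (\<lambda>n. G 1 / b ^ Suc n)" using geometric_tail_sums[OF assms(1)] by (rule sums_summable)
  show "\<exists>N. \<forall>n\<ge>N. norm (of_int \<lfloor>(\<tau> ^^ n) v\<rfloor> / b ^ Suc n) \<le> G 1 / b ^ Suc n"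
    using digit_less[OF assms(2)] digit_nonneg[OF assms(2)] assms(1)
    by (auto intro!: exI[of _ 0] divide_right_mono simp: less_imp_le abs_mult)
qed

lemma series_eq:
  assumes "1 < b" "v \<in> {0..<G 1}"
  shows "digit_series G b v = (of_int \<lfloor>v\<rfloor> + digit_series G b (\<tau> v)) / b"
proof -
  have "digit_series G b v = of_int \<lfloor>v\<rfloor> / b + (\<Sum>n. of_int \<lfloor>(\<tau> ^^ Suc n) v\<rfloor> / b ^ Suc (Suc n))"
    unfolding digit_series_def using suminf_split_head[OF digit_summable[OF assms]] by simp
  also have "(\<Sum>n. of_int \<lfloor>(\<tau> ^^ Suc n) v\<rfloor> / b ^ Suc (Suc n)) =
     (\<Sum>n. (of_int \<lfloor>(\<tau> ^^ n) (\<tau> v)\<rfloor> / b ^ Suc n) / b)"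
    by (simp add: funpow_swap1 mult.commute)
  also have "\<dots> = digit_series G b (\<tau> v) / b"
    unfolding digit_series_def by (rule suminf_divide[OF digit_summable[OF assms(1) tau_in]])
  finally show ?thesis by (simp add: add_divide_distrib)
qed

lemma series_nonneg: "1 < b \<Longrightarrow> v \<in> {0..<G 1} \<Longrightarrow> 0 \<le> digit_series G b v"
  unfolding digit_series_def
  by (intro suminf_nonneg digit_summable divide_nonneg_nonneg digit_nonneg) auto

lemma series_le:
  assumes "1 < b" "v \<in> {0..<G 1}"
  shows "digit_series G b v \<le> G 1 / (b - 1)"
proof -
  have "digit_series G b v \<le> (\<Sum>n. G 1 / b ^ Suc n)"
    unfolding digit_series_def using assms digit_less[OF assms(2)] geometric_tail_sums[OF assms(1)]
    by (intro suminf_le digit_summable divide_right_mono) (auto simp: less_imp_le sums_iff)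
  then show ?thesis using geometric_tail_sums[OF assms(1)] by (simp add: sums_iff)
qed

lemma series_0: "digit_series G b 0 = 0"
proof -
  have "\<tau> 0 = 0" by (simp add: floor_map_def)
  then have "(\<tau> ^^ n) 0 = 0" for n by (induction n) auto
  then show ?thesis by (simp add: digit_series_def)
qed

lemma series_int: "1 < b \<Longrightarrow> of_int k \<in> {0..<G 1} \<Longrightarrow> digit_series G b (of_int k) = of_int k / b"
  using series_eq[of b "of_int k"] series_0 tau_eq_0_iff[of "of_int k"] by simp

lemma series_ge_digit:
  assumes "1 < b" "v \<in> {0..<G 1}"
  shows "of_int \<lfloor>(\<tau> ^^ n) v\<rfloor> / b ^ Suc n \<le> digit_series G b v"
proof -
  have "sum (\<lambda>n. of_int \<lfloor>(\<tau> ^^ n) v\<rfloor> / b ^ Suc n) {n} \<le> digit_series G b v"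
    unfolding digit_series_def using assms digit_nonneg[OF assms(2)]
    by (intro sum_le_suminf digit_summable) auto
  then show ?thesis by simp
qed

lemma series_pos:
  assumes "1 < b" "v \<in> {0..<G 1}" "0 < v"
  shows "0 < digit_series G b v"
proof -
  obtain n where n: "\<lfloor>(\<tau> ^^ n) 0\<rfloor> < \<lfloor>(\<tau> ^^ n) v\<rfloor>"
    using orbits_separate[of 0 v] assms by auto
  have "0 \<le> \<lfloor>(\<tau> ^^ n) 0\<rfloor>" using tau_iter_in[of 0 n] G1_gt_1 by auto
  with n have "(0::real) < of_int \<lfloor>(\<tau> ^^ n) v\<rfloor>" by linarith
  then have "0 < of_int \<lfloor>(\<tau> ^^ n) v\<rfloor> / b ^ Suc n" using assms by (intro divide_pos_pos) auto
  with series_ge_digit[OF assms(1,2), of n] show ?thesis by linarith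
qed

text \<open>This makes \<open>b * digit_sup G b\<close> non-increasing in \<open>b\<close>. It yields the uniqueness of the base with
\<open>digit_sup G b = 1\<close> and turns estimates of the supremum at a fixed base into estimates of that base.\<close>

lemma series_scale:
  assumes "1 < b" "b \<le> c" "v \<in> {0..<G 1}"
  shows "c * digit_series G c v \<le> b * digit_series G b v"
proof -
  have le: "of_int \<lfloor>(\<tau> ^^ n) v\<rfloor> / c ^ n \<le> of_int \<lfloor>(\<tau> ^^ n) v\<rfloor> / b ^ n" for n
    using assms digit_nonneg[OF assms(3), of n]
    by (intro divide_left_mono power_mono) auto
  have *: "(\<lambda>n. of_int \<lfloor>(\<tau> ^^ n) v\<rfloor> / x ^ n) sums (x * digit_series G x v)" if "1 < x" for x
    using sums_mult[OF summable_sums[OF digit_summable[OF that assms(3)]], of x] that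
    unfolding digit_series_def by simp
  show ?thesis using assms by (intro sums_le[OF le * *]) auto
qed

lemma bdd_above_series: "1 < b \<Longrightarrow> bdd_above (digit_series G b ` {0..<G 1})"
  using series_le by (intro bdd_aboveI2) auto

lemma series_le_sup: "1 < b \<Longrightarrow> v \<in> {0..<G 1} \<Longrightarrow> digit_series G b v \<le> digit_sup G b"
  unfolding digit_sup_def by (intro cSUP_upper bdd_above_series)

lemma sup_le: "(\<And>v. v \<in> {0..<G 1} \<Longrightarrow> digit_series G b v \<le> c) \<Longrightarrow> digit_sup G b \<le> c"
  unfolding digit_sup_def using G1_gt_1 by (intro cSUP_least) auto

lemma sup_scale:
  assumes "1 < b" "b \<le> c"
  shows "c * digit_sup G c \<le> b * digit_sup G b"
proof -
  have "digit_sup G c \<le> b * digit_sup G b / c"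
  proof (rule sup_le)
    fix v assume v: "v \<in> {0..<G 1}"
    have "c * digit_series G c v \<le> b * digit_sup G b"
      using series_scale[OF assms v] series_le_sup[OF assms(1) v] assms
      by (meson less_trans mult_left_mono order_trans zero_less_one less_imp_le)
    then show "digit_series G c v \<le> b * digit_sup G b / c"
      using assms by (simp add: field_simps)
  qed
  then show ?thesis using assms by (simp add: field_simps)
qed

lemma sup_1_unique:
  assumes "1 < b" "digit_sup G b = 1" "1 < c" "digit_sup G c = 1"
  shows "b = c"
  using sup_scale[of b c] sup_scale[of c b] assms by (cases "b \<le> c") auto

end

lemma same_floor_right:
  fixes m y :: real
  assumes "m < y"
  obtains z where "m < z" "z < y" "\<lfloor>z\<rfloor> = \<lfloor>m\<rfloor>"
proof -
  define z where "z = min ((m + y) / 2) ((m + (of_int \<lfloor>m\<rfloor> + 1)) / 2)"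
  have m: "of_int \<lfloor>m\<rfloor> \<le> m" "m < of_int \<lfloor>m\<rfloor> + 1" by linarith+
  have "m < z" "z < y" using assms m by (auto simp: z_def min_def field_simps)
  moreover have "z < of_int \<lfloor>m\<rfloor> + 1" using m(2) unfolding z_def min_less_iff_disj by (simp add: add.commute)
  then have "\<lfloor>z\<rfloor> = \<lfloor>m\<rfloor>" using \<open>m < z\<close> m(1) by linarith
  ultimately show ?thesis by (rule that)
qed

context expanding_branch begin

lemma sup_nonneg: "1 < b \<Longrightarrow> 0 \<le> digit_sup G b"
  using series_le_sup[of b 0] series_0 G1_gt_1 by auto

lemma series_lipschitz:
  assumes b: "1 < a" "a \<le> b" "b \<le> c" and v: "v \<in> {0..<G 1}"
  shows "digit_series G b v - digit_series G c v \<le> (G 1 + G 1 / (a - 1)) / (1 - 1 / a) * (c - b)"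
proof -
  let ?C = "G 1 + G 1 / (a - 1)"
  let ?f = "\<lambda>v. digit_series G b v - digit_series G c v"
  have C: "0 \<le> ?C" using b G1_gt_1 by (intro add_nonneg_nonneg divide_nonneg_nonneg) auto
  have "?f v \<le> (?C * (c - b)) / (1 - 1 / b)"
  proof (rule contraction_upper_bound[where A = "{0..<G 1}" and f = ?f])
    show "bdd_above (?f ` {0..<G 1})"
    proof (rule bdd_aboveI2)
      fix x assume "x \<in> {0..<G 1}"
      then show "?f x \<le> G 1 / (b - 1)" using b series_le[of b x] series_nonneg[of c x] by auto
    qed
    fix x assume x: "x \<in> {0..<G 1}"
    have "digit_series G c (\<tau> x) \<le> G 1 / (c - 1)" using b by (intro series_le tau_in) auto
    also have "\<dots> \<le> G 1 / (a - 1)" using b G1_gt_1 by (intro divide_left_mono) auto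
    finally have le: "of_int \<lfloor>x\<rfloor> + digit_series G c (\<tau> x) \<le> ?C"
      using digit_less[OF x, of 0] by simp
    have "?f x = (1/b - 1/c) * (of_int \<lfloor>x\<rfloor> + digit_series G c (\<tau> x)) + 1 / b * ?f (\<tau> x)"
      using b x by (simp add: series_eq[of b x] series_eq[of c x] field_simps)
    also have "(1/b - 1/c) * (of_int \<lfloor>x\<rfloor> + digit_series G c (\<tau> x)) \<le> (1/b - 1/c) * ?C"
      using le b by (intro mult_left_mono) (auto simp: field_simps)
    also have "1/b - 1/c \<le> c - b"
    proof -
      have "1 * (c - b) \<le> (b * c) * (c - b)" using b mult_mono[of 1 b 1 c] by (intro mult_right_mono) auto
      moreover have "1/b - 1/c = (c - b) / (b * c)" using b by (simp add: field_simps)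
      ultimately show ?thesis using b by (simp add: pos_divide_le_eq mult.commute)
    qed
    finally show "\<exists>y\<in>{0..<G 1}. ?f x \<le> ?C * (c - b) + 1 / b * ?f y"
      using C tau_in[of x] by (auto simp: mult.commute mult_right_mono)
  qed (use b v in auto)
  also have "\<dots> \<le> (?C * (c - b)) / (1 - 1 / a)"
    using b C by (intro divide_left_mono mult_nonneg_nonneg mult_pos_pos) (auto simp: field_simps)
  finally show ?thesis by simp
qed

lemma sup_continuous:
  assumes "1 < a"
  shows "continuous_on {a..} (digit_sup G)"
proof -
  define K where "K = (G 1 + G 1 / (a - 1)) / (1 - 1 / a)"
  have K: "0 \<le> K" unfolding K_def using assms G1_gt_1
    by (intro add_nonneg_nonneg divide_nonneg_nonneg) auto
  have *: "\<bar>digit_sup G b - digit_sup G c\<bar> \<le> K * \<bar>b - c\<bar>" if bc: "a \<le> b" "b \<le> c" for b c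
  proof -
    have "digit_sup G b \<le> digit_sup G c + K * (c - b)"
    proof (rule sup_le)
      fix v assume v: "v \<in> {0..<G 1}"
      show "digit_series G b v \<le> digit_sup G c + K * (c - b)"
        using series_lipschitz[OF assms bc v] series_le_sup[of c v] v bc assms unfolding K_def by simp
    qed
    moreover have "digit_sup G c \<le> digit_sup G b"
    proof -
      have "c * digit_sup G c \<le> b * digit_sup G b" using sup_scale[of b c] bc assms by auto
      also have "\<dots> \<le> c * digit_sup G b" using bc assms sup_nonneg[of b] by (intro mult_right_mono) auto
      finally show ?thesis using bc assms by auto
    qed
    ultimately show ?thesis using bc by auto
  qed
  have "K-lipschitz_on {a..} (digit_sup G)"
  proof (rule lipschitz_onI)
    fix x y assume "x \<in> {a..}" "y \<in> {a..}"
    then show "dist (digit_sup G x) (digit_sup G y) \<le> K * dist x y"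
      using *[of x y] *[of y x] by (cases "x \<le> y") (auto simp: dist_real_def abs_minus_commute)
  qed (rule K)
  then show ?thesis by (rule lipschitz_on_continuous_on)
qed

text \<open>Some orbit has the digit \<open>1\<close> followed by another non-zero digit, say \<open>n + 1\<close> steps later. Its series
tends to at least \<open>2\<close> as \<open>b\<close> tends to \<open>1\<close>, and \<open>b = root (n + 2) 2\<close> is already close enough.\<close>

lemma ex_sup_ge_1: "\<exists>b>1. 1 \<le> digit_sup G b"
proof -
  define u where "u = min (1/2) ((G 1 - 1) / 2)"
  have u: "0 < u" "u < 1" "1 + u < G 1" using G1_gt_1 by (auto simp: u_def min_def field_simps)
  have fl: "\<lfloor>1 + u\<rfloor> = 1" using u by (intro floor_unique) auto
  have pos: "0 < G u" using G_less[of 0 u] u by simp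
  have Gu: "\<tau> (1 + u) = G u" using tau_int_add[of u 1] u by simp
  obtain n where n: "\<lfloor>(\<tau> ^^ n) 0\<rfloor> < \<lfloor>(\<tau> ^^ n) (G u)\<rfloor>"
    using orbits_separate[of 0 "G u"] pos G_bounds[of u] u by auto
  have "0 \<le> \<lfloor>(\<tau> ^^ n) 0\<rfloor>" using tau_iter_in[of 0 n] G1_gt_1 by auto
  with n have n1: "(1::real) \<le> of_int \<lfloor>(\<tau> ^^ n) (G u)\<rfloor>" by linarith
  define b where "b = root (n + 2) 2"
  have b: "1 < b" "b ^ (n + 2) = 2" unfolding b_def by (simp, rule real_root_pow_pos) auto
  have "1 / b ^ Suc n \<le> of_int \<lfloor>(\<tau> ^^ n) (G u)\<rfloor> / b ^ Suc n"
    using n1 b by (intro divide_right_mono) auto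
  also have "\<dots> \<le> digit_series G b (G u)"
    using G_bounds[of u] u b by (intro series_ge_digit) auto
  finally have "(1 + 1 / b ^ Suc n) / b \<le> (1 + digit_series G b (G u)) / b"
    using b by (intro divide_right_mono) auto
  also have "\<dots> = digit_series G b (1 + u)"
    using series_eq[of b "1 + u"] b u fl Gu by simp
  also have "\<dots> \<le> digit_sup G b" using b u by (intro series_le_sup) auto
  finally have "(1 + 1 / b ^ Suc n) / b \<le> digit_sup G b" .
  moreover have "1 \<le> (1 + 1 / b ^ Suc n) / b"
  proof -
    have "1 \<le> b ^ Suc n" using b by (intro one_le_power) auto
    moreover have "b * b ^ Suc n = 2" using b(2) by (simp add: mult.assoc)
    ultimately have "b * b ^ Suc n \<le> b ^ Suc n + 1" by linarith
    then show ?thesis using b(1) by (simp add: field_simps)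
  qed
  ultimately have "1 \<le> digit_sup G b" by linarith
  then show ?thesis using b(1) by blast
qed

lemma ex_sup_1: "\<exists>b>1. digit_sup G b = 1"
proof -
  obtain a where a: "1 < a" "1 \<le> digit_sup G a" using ex_sup_ge_1 by auto
  define c where "c = max a (G 1 + 1)"
  have c: "a \<le> c" "1 < c" using a G1_gt_1 by (auto simp: c_def)
  have "digit_sup G c \<le> G 1 / (c - 1)" using c by (intro sup_le series_le) auto
  also have "\<dots> \<le> 1" using c a G1_gt_1 by (auto simp: c_def max_def)
  finally have "digit_sup G c \<le> 1" .
  then obtain b where "a \<le> b" "b \<le> c" "digit_sup G b = 1"
    using IVT2'[of "digit_sup G" c 1 a] a c continuous_on_subset[OF sup_continuous[OF a(1)], of "{a..c}"]
    by auto
  then show ?thesis using a by (intro exI[of _ b]) auto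
qed

context
  fixes b :: real
  assumes b_gt_1: "1 < b" and sup_1: "digit_sup G b = 1"
begin

abbreviation "S \<equiv> digit_series G b"

lemma series_le_1: "v \<in> {0..<G 1} \<Longrightarrow> S v \<le> 1"
  using series_le_sup[OF b_gt_1, of v] sup_1 by simp

lemma series_gt:
  assumes "t < 1"
  obtains v where "0 \<le> v" "v < G 1" "t < S v"
proof -
  have "t < (SUP v\<in>{0..<G 1}. S v)" using sup_1 assms by (simp add: digit_sup_def)
  then obtain v where "v \<in> {0..<G 1}" "t < S v"
    using less_cSUP_iff[of "{0..<G 1}" S t] bdd_above_series[OF b_gt_1] G1_gt_1 by auto
  then show ?thesis using that by auto
qed

lemma b_series: "v \<in> {0..<G 1} \<Longrightarrow> b * S v = of_int \<lfloor>v\<rfloor> + S (\<tau> v)"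
  using series_eq[OF b_gt_1, of v] b_gt_1 by simp

text \<open>If the leading digits differ, a difference of one outweighs the tails, which lie between \<open>0\<close> and
\<open>1\<close>; if they agree, the difference is \<open>1 / b\<close> times the one for the images.\<close>

lemma series_mono:
  assumes "0 \<le> x" "x \<le> y" "y < G 1"
  shows "S x \<le> S y"
proof -
  let ?A = "{p. 0 \<le> fst p \<and> fst p \<le> snd p \<and> snd p < G 1}"
  let ?f = "\<lambda>p. S (fst p) - S (snd p)"
  have "?f (x, y) \<le> 0 / (1 - 1 / b)"
  proof (rule contraction_upper_bound[where A = ?A and f = ?f])
    show "bdd_above (?f ` ?A)"
    proof (rule bdd_aboveI2)
      fix p :: "real \<times> real" assume "p \<in> ?A"
      then show "?f p \<le> 1" using series_le_1[of "fst p"] series_nonneg[OF b_gt_1, of "snd p"] by auto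
    qed
    fix p :: "real \<times> real" assume p: "p \<in> ?A"
    obtain x y where xy: "p = (x, y)" by force
    have in_x: "x \<in> {0..<G 1}" and in_y: "y \<in> {0..<G 1}" and le: "x \<le> y" using p xy by auto
    have e: "S x - S y = (of_int \<lfloor>x\<rfloor> - of_int \<lfloor>y\<rfloor> + (S (\<tau> x) - S (\<tau> y))) / b"
      using series_eq[OF b_gt_1 in_x] series_eq[OF b_gt_1 in_y] by (simp add: diff_divide_distrib add_divide_distrib)
    show "\<exists>q\<in>?A. ?f p \<le> 0 + 1 / b * ?f q"
    proof (cases "\<lfloor>x\<rfloor> = \<lfloor>y\<rfloor>")
      case True
      then have "(\<tau> x, \<tau> y) \<in> ?A" using tau_le[OF le True] tau_range by auto
      then show ?thesis using e True xy by (intro bexI[of _ "(\<tau> x, \<tau> y)"]) auto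
    next
      case False
      then have "\<lfloor>x\<rfloor> + 1 \<le> \<lfloor>y\<rfloor>" using floor_mono[OF le] by linarith
      then have "of_int \<lfloor>x\<rfloor> - of_int \<lfloor>y\<rfloor> \<le> (-1::real)" by linarith
      then have "of_int \<lfloor>x\<rfloor> - of_int \<lfloor>y\<rfloor> + (S (\<tau> x) - S (\<tau> y)) \<le> 0"
        using series_le_1[OF tau_in, of x] series_nonneg[OF b_gt_1 tau_in, of y] by linarith
      then have "S x - S y \<le> 0" unfolding e using b_gt_1 by (simp add: divide_nonpos_pos)
      then show ?thesis using xy G1_gt_1 by (intro bexI[of _ "(0, 0)"]) auto
    qed
  qed (use assms b_gt_1 in auto)
  then show ?thesis by simp
qed

text \<open>To the right of the integer the tail is positive, while the tail on the left is at most \<open>1\<close>. The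
point \<open>y\<close> strictly beyond \<open>m\<close> excludes the borderline case of tails \<open>1\<close> and \<open>0\<close>.\<close>

lemma no_constancy_across_integer:
  assumes "0 \<le> x" "x < m" "m < y" "y < G 1" and fl: "\<lfloor>x\<rfloor> < \<lfloor>m\<rfloor>" and eq: "S x = S y"
  shows False
proof -
  obtain z where z: "m < z" "z < y" "\<lfloor>z\<rfloor> = \<lfloor>m\<rfloor>" using same_floor_right assms by blast
  have "S x = S z" using series_mono[of x z] series_mono[of z y] assms z eq by auto
  then have "b * S x = b * S z" by simp
  moreover have "b * S x = of_int \<lfloor>x\<rfloor> + S (\<tau> x)" using assms by (intro b_series) auto
  moreover have "b * S z = of_int \<lfloor>m\<rfloor> + S (\<tau> z)" using assms z b_series[of z] by auto
  moreover have "0 < S (\<tau> z)"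
  proof (rule series_pos[OF b_gt_1 tau_in])
    show "0 < \<tau> z" using tau_less[of m z] z tau_range(1)[of m] by linarith
  qed
  moreover have "S (\<tau> x) \<le> 1" by (rule series_le_1[OF tau_in])
  moreover have "of_int \<lfloor>x\<rfloor> + 1 \<le> (of_int \<lfloor>m\<rfloor> :: real)" using fl by linarith
  ultimately show False by linarith
qed

lemma series_strict_mono: "strict_mono_on {0..<G 1} S"
proof (rule strict_mono_onI)
  fix x y assume xy: "x \<in> {0..<G 1}" "y \<in> {0..<G 1}" "x < y"
  \<comment> \<open>An interval of constancy is carried by \<open>\<tau>\<close> to another one as long as its points \<open>x\<close> and \<open>m\<close>
      have equal digits. The right end may stick out over the next integer and is pulled back to \<open>z\<close>.\<close>
  have no_const: False
    if "\<And>j. j < n \<Longrightarrow> \<lfloor>(\<tau> ^^ j) x\<rfloor> = \<lfloor>(\<tau> ^^ j) m\<rfloor>" "\<lfloor>(\<tau> ^^ n) x\<rfloor> < \<lfloor>(\<tau> ^^ n) m\<rfloor>"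
      "0 \<le> x" "x < m" "m < y" "y < G 1" "S x = S y" for n x m y
    using that
  proof (induction n arbitrary: x m y)
    case 0
    then show ?case using no_constancy_across_integer[of x m y] by auto
  next
    case (Suc n)
    have fl: "\<lfloor>x\<rfloor> = \<lfloor>m\<rfloor>" using Suc.prems(1)[of 0] by simp
    obtain z where z: "m < z" "z < y" "\<lfloor>z\<rfloor> = \<lfloor>m\<rfloor>" using same_floor_right Suc.prems by blast
    have "S x = S z" using series_mono[of x z] series_mono[of z y] Suc.prems z by auto
    then have "S (\<tau> x) = S (\<tau> z)" using b_series[of x] b_series[of z] Suc.prems z fl by auto
    then show ?case
      using Suc.IH[of "\<tau> x" "\<tau> m" "\<tau> z"] Suc.prems(1)[of "Suc _"] Suc.prems(2) fl z(3)
        tau_less[of x m] tau_less[of m z] Suc.prems(4) z(1) tau_range(1)[of x] tau_range(2)[of z]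
      by (simp add: funpow_swap1[symmetric])
  qed
  let ?m = "(x + y) / 2"
  obtain n where "\<And>j. j < n \<Longrightarrow> \<lfloor>(\<tau> ^^ j) x\<rfloor> = \<lfloor>(\<tau> ^^ j) ?m\<rfloor>" "\<lfloor>(\<tau> ^^ n) x\<rfloor> < \<lfloor>(\<tau> ^^ n) ?m\<rfloor>"
    using orbits_separate[of x ?m] xy by auto
  then have "S x \<noteq> S y" using no_const[of n x ?m y] xy by auto
  then show "S x < S y" using series_mono[of x y] xy by auto
qed

lemma series_less_1: "v \<in> {0..<G 1} \<Longrightarrow> S v < 1"
  using strict_mono_onD[OF series_strict_mono, of v "(v + G 1) / 2"] series_le_1[of "(v + G 1) / 2"]
  by auto

text \<open>A jump of the series at \<open>x\<close> is \<open>1 / b\<close> times a jump at \<open>\<tau> x\<close>, and jumps are bounded, so there are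
none. At an integer \<open>k > 0\<close> the left limit of the series is \<open>k / b\<close>, as the tail there has supremum
\<open>1\<close>; what remains to the right is \<open>1 / b\<close> times a jump at \<open>0\<close>.\<close>

lemma no_gap:
  assumes x: "0 \<le> x" "x < G 1" and s: "0 \<le> s"
    and below: "\<And>v. 0 \<le> v \<Longrightarrow> v < x \<Longrightarrow> S v \<le> s"
    and above: "\<And>v. x < v \<Longrightarrow> v < G 1 \<Longrightarrow> t \<le> S v"
  shows "t \<le> s"
proof -
  define A where "A = {(x, s, t). 0 \<le> x \<and> x < G 1 \<and> 0 \<le> s \<and>
     (\<forall>v. 0 \<le> v \<and> v < x \<longrightarrow> S v \<le> s) \<and> (\<forall>v. x < v \<and> v < G 1 \<longrightarrow> t \<le> S v)}"
  let ?f = "\<lambda>(x::real, s, t). t - s"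
  have "?f (x, s, t) \<le> 0 / (1 - 1 / b)"
  proof (rule contraction_upper_bound[where A = A and f = ?f])
    show "bdd_above (?f ` A)"
    proof (rule bdd_aboveI2)
      fix p assume p: "p \<in> A"
      obtain x s t where xst: "p = (x, s, t)" using prod_cases3 by blast
      have "t \<le> S ((x + G 1) / 2)" "0 \<le> s" "0 \<le> x" "x < G 1" using p xst by (auto simp: A_def)
      then show "?f p \<le> 1" using series_le_1[of "(x + G 1) / 2"] xst by auto
    qed
    fix p assume p: "p \<in> A"
    obtain x s t where xst: "p = (x, s, t)" using prod_cases3 by blast
    have x: "0 \<le> x" "x < G 1" and s: "0 \<le> s"
      and below: "\<And>v. 0 \<le> v \<Longrightarrow> v < x \<Longrightarrow> S v \<le> s"
      and above: "\<And>v. x < v \<Longrightarrow> v < G 1 \<Longrightarrow> t \<le> S v"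
      using p by (auto simp: A_def xst)
    define k where "k = \<lfloor>x\<rfloor>"
    have k: "of_int k \<le> x" "x < of_int k + 1" "0 \<le> k" using x by (auto simp: k_def)
    have s_ge: "of_int k / b \<le> s"
    proof (cases "x = of_int k")
      case False
      then show ?thesis using below[of "of_int k"] k x series_int[OF b_gt_1, of k] by auto
    next
      case int: True
      show ?thesis
      proof (cases "k = 0")
        case True
        then show ?thesis using s by simp
      next
        case False
        then have k1: "0 \<le> k - 1" using k by auto
        have "digit_sup G b \<le> b * s - of_int (k - 1)"
        proof (rule sup_le)
          fix w assume "w \<in> {0..<G 1}"
          then obtain u where u: "0 \<le> u" "u < 1" "G u = w" using G_surj by auto
          have v: "0 \<le> of_int (k - 1) + u" "of_int (k - 1) + u < x"
            using k1 u int by auto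
          have "\<lfloor>of_int (k - 1) + u\<rfloor> = k - 1" using u by (intro floor_unique) auto
          then have "b * S (of_int (k - 1) + u) = of_int (k - 1) + S w"
            using b_series[of "of_int (k - 1) + u"] v x tau_int_add[of u "k - 1"] u by auto
          moreover have "b * S (of_int (k - 1) + u) \<le> b * s" using below[OF v] b_gt_1 by auto
          ultimately show "S w \<le> b * s - of_int (k - 1)" by linarith
        qed
        then show ?thesis using sup_1 b_gt_1 by (simp add: field_simps)
      qed
    qed
    have above': "b * t - of_int k \<le> S w" if w: "\<tau> x < w" "w < G 1" for w
    proof -
      define u where "u = min ((1 + frac x) / 2) (frac x + (G 1 - x) / 2)"
      have u: "frac x < u" "u < 1" "of_int k + u < G 1"
        using frac_lt_1[of x] x by (auto simp: u_def min_def frac_def k_def field_simps)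
      have u0: "0 \<le> u" using u frac_ge_0[of x] by linarith
      obtain u' where u': "0 \<le> u'" "u' < 1" "G u' = w" using G_surj[of w] w tau_range(1)[of x] by auto
      have "frac x < u'"
        using G_le[of u' "frac x"] w u' frac_lt_1[of x] unfolding floor_map_def by (cases "frac x < u'") auto
      define y where "y = min u u'"
      have y: "frac x < y" "y < 1" "of_int k + y < G 1" "y \<le> u'" "0 \<le> y"
        using u u' u0 \<open>frac x < u'\<close> by (auto simp: y_def)
      have xy: "x < of_int k + y" using y(1) by (simp add: frac_def k_def)
      have fl: "\<lfloor>of_int k + y\<rfloor> = k" using y by (intro floor_unique) auto
      have "b * t \<le> b * S (of_int k + y)" using above[OF xy y(3)] b_gt_1 by auto
      also have "\<dots> = of_int k + S (G y)"
        using b_series[of "of_int k + y"] xy x y fl tau_int_add[of y k] by auto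
      also have "S (G y) \<le> S w"
        using series_mono[of "G y" w] y u' w G_le[of y u'] G_bounds[of y] by auto
      finally show ?thesis by simp
    qed
    define q where "q = (\<tau> x, (if x = of_int k then 0 else b * s - of_int k), b * t - of_int k)"
    have "q \<in> A"
    proof (cases "x = of_int k")
      case True
      then have "\<tau> x = 0" by (simp add: tau_eq_0_iff)
      then show ?thesis using above' G1_gt_1 True by (auto simp: A_def q_def)
    next
      case False
      have "S w \<le> b * s - of_int k" if w: "0 \<le> w" "w < \<tau> x" for w
      proof -
        obtain u where u: "0 \<le> u" "u < 1" "G u = w" using G_surj[of w] w tau_range(2)[of x] by auto
        have ux: "u < frac x"
          using G_le[of "frac x" u] w u unfolding floor_map_def by (cases "u < frac x") auto
        have v: "0 \<le> of_int k + u" "of_int k + u < x" using k u ux by (auto simp: frac_def k_def)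
        have "\<lfloor>of_int k + u\<rfloor> = k" using u by (intro floor_unique) auto
        then have "b * S (of_int k + u) = of_int k + S w"
          using b_series[of "of_int k + u"] v x tau_int_add[of u k] u by auto
        moreover have "b * S (of_int k + u) \<le> b * s" using below[OF v] b_gt_1 by auto
        ultimately show ?thesis by linarith
      qed
      then show ?thesis using above' False s_ge b_gt_1 tau_range[of x]
        by (auto simp: A_def q_def field_simps)
    qed
    moreover have "?f p \<le> 0 + 1 / b * ?f q"
      using s_ge b_gt_1 by (auto simp: xst q_def field_simps)
    ultimately show "\<exists>q\<in>A. ?f p \<le> 0 + 1 / b * ?f q" by blast
  qed (use assms b_gt_1 in \<open>auto simp: A_def\<close>)
  then show ?thesis by simp
qed

lemma series_onto: "S ` {0..<G 1} = {0..<1}"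
proof (intro equalityI subsetI)
  fix t assume "t \<in> S ` {0..<G 1}"
  then show "t \<in> {0..<1}" using series_less_1 series_nonneg[OF b_gt_1] by auto
next
  fix t :: real assume t: "t \<in> {0..<1}"
  define X where "X = {v. 0 \<le> v \<and> v < G 1 \<and> S v \<le> t}"
  obtain v where v: "0 \<le> v" "v < G 1" "t < S v" using series_gt[of t] t by auto
  have X_ub: "z \<le> v" if "z \<in> X" for z
    using series_mono[of v z] that v by (cases "z \<le> v") (auto simp: X_def)
  have X0: "0 \<in> X" using t series_0 G1_gt_1 by (auto simp: X_def)
  have bdd: "bdd_above X" using X_ub by (intro bdd_aboveI)
  define x where "x = Sup X"
  have x: "0 \<le> x" "x < G 1"
    using cSup_upper[OF X0 bdd] cSup_least[of X v] X0 X_ub v unfolding x_def by (blast, force)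
  have below: "S z \<le> t" if "0 \<le> z" "z < x" for z
  proof -
    obtain y where "y \<in> X" "z < y" using less_cSupD[of X z] X0 \<open>z < x\<close> unfolding x_def by blast
    then show ?thesis using series_mono[of z y] that by (auto simp: X_def)
  qed
  have above: "t \<le> S z" if "x < z" "z < G 1" for z
    using cSup_upper[OF _ bdd, of z] that x unfolding x_def[symmetric] by (force simp: X_def)
  have "t \<le> S x"
    using no_gap[of x "S x" t] x above series_nonneg[OF b_gt_1, of x] series_mono[of _ x] by auto
  moreover have "S x \<le> t"
    using no_gap[of x t "S x"] x below t series_mono[of x] by auto
  ultimately show "t \<in> S ` {0..<G 1}" using x by (intro image_eqI[of _ _ x]) auto
qed

lemma series_homeomorphism: "\<exists>\<psi>. homeomorphism {0..<G 1} {0..<1} S \<psi>"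
  using series_strict_mono series_onto G1_gt_1 by (intro strict_mono_onto_imp_homeomorphism) auto

lemma sup_1_imp_conjugate: "conjugate_floor_map G b"
proof -
  obtain \<psi> where \<psi>: "homeomorphism {0..<G 1} {0..<1} S \<psi>" using series_homeomorphism by blast
  have "S (\<tau> v) = S_map b (S v)" if v: "v \<in> {0..<G 1}" for v
  proof -
    have "S (\<tau> v) \<in> {0..<1}" using series_onto tau_in by blast
    then show ?thesis unfolding S_map_def b_series[OF v] by (simp add: frac_eq)
  qed
  with \<psi> show ?thesis unfolding conjugate_floor_map_def by blast
qed

end

end

text \<open>A continuous injection of an interval is monotone one way or the other, and the left endpoint, having
the least value, decides which.\<close>

lemma continuous_bij_strict_mono:
  fixes f :: "real \<Rightarrow> real"
  assumes cont: "continuous_on {a..<b} f" and inj: "inj_on f {a..<b}"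
    and onto: "f ` {a..<b} = {c..<d}" and fa: "f a = c"
  shows "strict_mono_on {a..<b} f"
proof (rule strict_mono_onI)
  fix x y assume xy: "x \<in> {a..<b}" "y \<in> {a..<b}" "x < y"
  have ne: "f x \<noteq> f y" using inj xy by (auto dest: inj_onD)
  have lo: "f a < f z" if "z \<in> {a..<b}" "z \<noteq> a" for z
  proof -
    have "f z \<noteq> f a" using inj_onD[OF inj, of z a] that by auto
    moreover have "f z \<in> {c..<d}" using onto that by blast
    ultimately show ?thesis using fa by auto
  qed
  show "f x < f y"
  proof (cases "x = a")
    case True
    then show ?thesis using lo[of y] xy by auto
  next
    case False
    have "(f a < f x \<and> f x < f y) \<or> (f y < f x \<and> f x < f a)"
      using xy False by (intro continuous_inj_imp_mono continuous_on_subset[OF cont] inj_on_subset[OF inj]) auto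
    then show ?thesis using lo[of x] xy False by auto
  qed
qed

context expanding_branch begin

text \<open>The zeros of \<open>\<tau>\<close> are the integers and those of \<open>S_map b\<close> are the multiples of \<open>1 / b\<close>. An increasing
conjugacy matches them in order, hence respects the digits, hence satisfies the self-similar
equation of the digit series and coincides with it.\<close>

lemma conjugate_imp_sup_1:
  assumes b: "1 < b" and conj: "conjugate_floor_map G b"
  shows "digit_sup G b = 1"
proof -
  obtain \<phi> \<psi> where hom: "homeomorphism {0..<G 1} {0..<1} \<phi> \<psi>"
    and eq: "\<And>v. v \<in> {0..<G 1} \<Longrightarrow> \<phi> (\<tau> v) = S_map b (\<phi> v)"
    using conj unfolding conjugate_floor_map_def by auto
  have onto: "\<phi> ` {0..<G 1} = {0..<1}" and cont: "continuous_on {0..<G 1} \<phi>"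
    using hom by (auto simp: homeomorphism_def)
  have inj: "inj_on \<phi> {0..<G 1}" using hom by (metis homeomorphism_apply1 inj_on_inverseI)
  have rng: "0 \<le> \<phi> v" "\<phi> v < 1" if "v \<in> {0..<G 1}" for v using onto that by auto
  have zero_iff: "v \<in> \<int> \<longleftrightarrow> b * \<phi> v \<in> \<int>" if v: "v \<in> {0..<G 1}" and zero: "\<phi> 0 = 0" for v
  proof -
    have "v \<in> \<int> \<longleftrightarrow> \<tau> v = 0" by (simp add: tau_eq_0_iff)
    also have "\<dots> \<longleftrightarrow> \<phi> (\<tau> v) = 0"
      using inj_on_eq_iff[OF inj tau_in, of 0 v] zero G1_gt_1 by auto
    also have "\<dots> \<longleftrightarrow> b * \<phi> v \<in> \<int>" using eq[OF v] by (simp add: S_map_def)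
    finally show ?thesis .
  qed
  have zero: "\<phi> 0 = 0"
  proof -
    have "\<exists>z\<in>{0..<G 1}. \<phi> z = 0" using onto by (metis imageE atLeastLessThan_iff order_refl zero_less_one)
    then obtain z where z: "z \<in> {0..<G 1}" "\<phi> z = 0" by auto
    show ?thesis
    proof (cases "z = 0")
      case False
      let ?w = "(z + G 1) / 2"
      have "(\<phi> 0 < \<phi> z \<and> \<phi> z < \<phi> ?w) \<or> (\<phi> ?w < \<phi> z \<and> \<phi> z < \<phi> 0)"
        using z False by (intro continuous_inj_imp_mono continuous_on_subset[OF cont] inj_on_subset[OF inj]) auto
      then show ?thesis using rng(1)[of 0] rng(1)[of ?w] z G1_gt_1 by auto
    qed (use z in simp)
  qed
  have mono: "strict_mono_on {0..<G 1} \<phi>"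
    using cont inj onto zero by (rule continuous_bij_strict_mono)
  have int_hit: "\<exists>k. v = of_int k" if v: "v \<in> {0..<G 1}" and "b * \<phi> v = of_int j" for v j
    using zero_iff[OF v zero] that by (auto elim: Ints_cases)
  have at_int: "b * \<phi> (real n) = real n" if "real n < G 1" for n
    using that
  proof (induction n)
    case 0
    then show ?case using zero by simp
  next
    case (Suc n)
    have in_n: "real n \<in> {0..<G 1}" "real (Suc n) \<in> {0..<G 1}" using Suc.prems by auto
    have IH: "b * \<phi> (real n) = real n" using Suc by auto
    have "b * \<phi> (real (Suc n)) \<in> \<int>" using zero_iff[OF in_n(2) zero] by simp
    then obtain j where j: "b * \<phi> (real (Suc n)) = of_int j" by (auto elim: Ints_cases)
    have "\<phi> (real n) < \<phi> (real (Suc n))" using strict_mono_onD[OF mono in_n] by simp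
    then have "b * \<phi> (real n) < b * \<phi> (real (Suc n))" using b by simp
    then have "int n < j" using IH j by linarith
    moreover have "\<not> int n + 1 < j"
    proof
      assume less: "int n + 1 < j"
      then have "real (Suc n) < b * \<phi> (real (Suc n))" using j by linarith
      then have lt: "real (Suc n) / b < \<phi> (real (Suc n))" using b by (simp add: field_simps)
      then have "real (Suc n) / b < 1" using rng(2)[OF in_n(2)] by linarith
      then have "real (Suc n) / b \<in> {0..<1}" using b by auto
      then obtain v where v: "v \<in> {0..<G 1}" "\<phi> v = real (Suc n) / b" using onto by (metis imageE)
      then obtain k where k: "v = of_int k" using int_hit[OF v(1), of "int (Suc n)"] b by auto
      have "v < real (Suc n)"
        using strict_mono_onD[OF mono in_n(2) v(1)] lt v by (cases v "real (Suc n)" rule: linorder_cases) auto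
      moreover have "real n < v"
      proof (rule ccontr)
        assume "\<not> real n < v"
        then have "\<phi> v \<le> \<phi> (real n)"
          by (intro mono_onD[OF strict_mono_on_imp_mono_on[OF mono] v(1) in_n(1)]) auto
        then have "b * \<phi> v \<le> real n" using IH b by (metis mult_left_mono less_imp_le less_trans zero_less_one)
        then show False using v(2) b by simp
      qed
      ultimately have "k < int n + 1" "int n < k" using k by linarith+
      then show False by linarith
    qed
    ultimately show ?case using j by simp
  qed
  have fl: "\<lfloor>b * \<phi> v\<rfloor> = \<lfloor>v\<rfloor>" if v: "v \<in> {0..<G 1}" for v
  proof (rule floor_unique)
    define n where "n = nat \<lfloor>v\<rfloor>"
    have n: "real n \<le> v" "v < real n + 1" "of_int \<lfloor>v\<rfloor> = real n" using v by (auto simp: n_def)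
    have in_n: "real n \<in> {0..<G 1}" using n v by auto
    have "\<phi> (real n) \<le> \<phi> v"
      using mono_onD[OF strict_mono_on_imp_mono_on[OF mono] in_n v n(1)] .
    then have "b * \<phi> (real n) \<le> b * \<phi> v" using b by simp
    then show "of_int \<lfloor>v\<rfloor> \<le> b * \<phi> v" using at_int[of n] in_n n by auto
    show "b * \<phi> v < of_int \<lfloor>v\<rfloor> + 1"
    proof (rule ccontr)
      assume "\<not> ?thesis"
      then have le: "(real n + 1) / b \<le> \<phi> v" using b n by (simp add: field_simps)
      then have "(real n + 1) / b < 1" using rng(2)[OF v] by linarith
      then have "(real n + 1) / b \<in> {0..<1}" using b by auto
      then obtain w where w: "w \<in> {0..<G 1}" "\<phi> w = (real n + 1) / b" using onto by (metis imageE)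
      then obtain k where k: "w = of_int k" using int_hit[OF w(1), of "int (Suc n)"] b by auto
      have "w \<le> v" using strict_mono_onD[OF mono v w(1)] le w by (cases "w \<le> v") auto
      then have "k \<le> int n" using k n by linarith
      then have "w \<le> real n" using k by linarith
      then have "\<phi> w \<le> \<phi> (real n)"
        using mono_onD[OF strict_mono_on_imp_mono_on[OF mono] w(1) in_n] by auto
      then have "b * \<phi> w \<le> b * \<phi> (real n)" using b by simp
      then show False using at_int[of n] in_n w b by auto
    qed
  qed
  have phi_eq: "\<phi> v = (of_int \<lfloor>v\<rfloor> + \<phi> (\<tau> v)) / b" if v: "v \<in> {0..<G 1}" for v
    using eq[OF v] fl[OF v] b by (simp add: S_map_def frac_def field_simps)
  have series: "digit_series G b v = \<phi> v" if v: "v \<in> {0..<G 1}" for v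
  proof -
    let ?f = "\<lambda>v. \<bar>digit_series G b v - \<phi> v\<bar>"
    have "?f v \<le> 0 / (1 - 1 / b)"
    proof (rule contraction_upper_bound[where A = "{0..<G 1}" and f = ?f])
      show "bdd_above (?f ` {0..<G 1})"
      proof (rule bdd_aboveI2)
        fix x assume x: "x \<in> {0..<G 1}"
        show "?f x \<le> G 1 / (b - 1) + 1"
          using series_le[OF b x] series_nonneg[OF b x] rng[OF x] by auto
      qed
      fix x assume x: "x \<in> {0..<G 1}"
      have "digit_series G b x - \<phi> x = (digit_series G b (\<tau> x) - \<phi> (\<tau> x)) / b"
        using series_eq[OF b x] phi_eq[OF x] by (simp add: diff_divide_distrib add_divide_distrib)
      then have "?f x = ?f (\<tau> x) / b" using b by simp
      then show "\<exists>y\<in>{0..<G 1}. ?f x \<le> 0 + 1 / b * ?f y"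
        using tau_in[of x] by (intro bexI[of _ "\<tau> x"]) auto
    qed (use b v in auto)
    then show ?thesis by simp
  qed
  have "digit_sup G b = (SUP v\<in>{0..<G 1}. \<phi> v)"
    unfolding digit_sup_def using series by (intro SUP_cong) auto
  also have "\<dots> = Sup {0..<1::real}" using onto by simp
  finally show ?thesis by simp
qed

lemma conjugate_iff: "1 < b \<Longrightarrow> conjugate_floor_map G b \<longleftrightarrow> digit_sup G b = 1"
  using conjugate_imp_sup_1 sup_1_imp_conjugate by blast

lemma conjugate_ex1: "\<exists>!b. 1 < b \<and> conjugate_floor_map G b"
  using ex_sup_1 sup_1_unique conjugate_iff by metis

lemma sup_1_ge_int:
  assumes b: "1 < b" "digit_sup G b = 1" and k: "of_int k < G 1" "0 \<le> k"
  shows "of_int k \<le> b"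
proof -
  have "of_int k / b \<le> 1"
    using series_int[OF b(1), of k] series_le_1[OF b, of "of_int k"] k by simp
  then show ?thesis using b by (simp add: pos_divide_le_eq)
qed

text \<open>When \<open>G\<close> is close to the identity on \<open>{0..<1}\<close>, the function \<open>v / c\<close> nearly satisfies the equation
of the digit series as an upper solution; its supremum is less than \<open>1\<close> if \<open>G 1 < c\<close> with enough room.\<close>

lemma sup_1_less:
  assumes b: "1 < b" "digit_sup G b = 1" and c: "1 < c"
    and near: "\<And>u. u \<in> {0..<1} \<Longrightarrow> G u \<le> u + e"
    and small: "G 1 + e / (c - 1) < c" and e: "0 \<le> e"
  shows "b < c"
proof (rule ccontr)
  assume "\<not> b < c"
  then have cb: "c \<le> b" by simp
  have "digit_sup G c \<le> G 1 / c + (e / c / c) / (1 - 1 / c)"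
  proof (rule sup_le)
    fix v assume v: "v \<in> {0..<G 1}"
    let ?f = "\<lambda>v. digit_series G c v - v / c"
    have "?f v \<le> (e / c / c) / (1 - 1 / c)"
    proof (rule contraction_upper_bound[where A = "{0..<G 1}" and f = ?f])
      show "bdd_above (?f ` {0..<G 1})"
      proof (rule bdd_aboveI2)
        fix x assume x: "x \<in> {0..<G 1}"
        have "0 \<le> x / c" using x c by auto
        then show "?f x \<le> G 1 / (c - 1)" using series_le[OF c x] by auto
      qed
      fix x assume x: "x \<in> {0..<G 1}"
      have fl: "0 \<le> (of_int \<lfloor>x\<rfloor>::real)" using x by auto
      have "G (frac x) \<le> frac x + e" using near[of "frac x"] frac_lt_1[of x] by auto
      then have "\<tau> x / c \<le> (x - of_int \<lfloor>x\<rfloor> + e) / c"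
        using c by (intro divide_right_mono) (auto simp: floor_map_def frac_def)
      also have "\<dots> \<le> (x - of_int \<lfloor>x\<rfloor>) + e / c"
        unfolding add_divide_distrib using c mult_left_mono[of 1 c "x - of_int \<lfloor>x\<rfloor>"]
        by (intro add_right_mono) (simp add: pos_divide_le_eq)
      finally have *: "of_int \<lfloor>x\<rfloor> + \<tau> x / c \<le> x + e / c" by simp
      have "?f x = (of_int \<lfloor>x\<rfloor> + \<tau> x / c - x + ?f (\<tau> x)) / c"
        using series_eq[OF c x] by (simp add: diff_divide_distrib add_divide_distrib)
      also have "\<dots> \<le> (e / c + ?f (\<tau> x)) / c" using * c by (intro divide_right_mono) auto
      also have "\<dots> = e / c / c + 1 / c * ?f (\<tau> x)" by (simp add: add_divide_distrib)
      finally show "\<exists>y\<in>{0..<G 1}. ?f x \<le> e / c / c + 1 / c * ?f y" using tau_in[of x] by blast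
    qed (use c v in auto)
    moreover have "v / c \<le> G 1 / c" using v c by (intro divide_right_mono) auto
    ultimately show "digit_series G c v \<le> G 1 / c + (e / c / c) / (1 - 1 / c)" by linarith
  qed
  also have "(e / c / c) / (1 - 1 / c) = e / (c - 1) / c" using c by (simp add: field_simps)
  finally have "digit_sup G c \<le> (G 1 + e / (c - 1)) / c" by (simp add: add_divide_distrib)
  then have "c * digit_sup G c \<le> G 1 + e / (c - 1)" using c by (simp add: pos_le_divide_eq mult.commute)
  moreover have "b \<le> c * digit_sup G c" using sup_scale[OF c cb] b by simp
  ultimately show False using small cb by linarith
qed

end

text \<open>By the contraction principle on pairs \<open>x \<le> y\<close>, the digit series of \<open>G\<close> in base \<open>c\<close> stays below
that of \<open>H\<close>. On \<open>{0..<G 1}\<close> the latter stays below its value at \<open>G 1\<close>, which is less than \<open>1\<close>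
because \<open>G 1\<close> lies inside the domain of \<open>H\<close>: this is where strictness comes from.\<close>

lemma sup_1_strict_mono:
  assumes "expanding_branch G" "expanding_branch H"
    and le: "\<And>u. u \<in> {0..<1} \<Longrightarrow> G u \<le> H u" and less: "G 1 < H 1"
    and b: "1 < b" "digit_sup G b = 1" and c: "1 < c" "digit_sup H c = 1"
  shows "b < c"
proof (rule ccontr)
  interpret G: expanding_branch G by fact
  interpret H: expanding_branch H by fact
  assume "\<not> b < c"
  then have cb: "c \<le> b" by simp
  have "digit_sup G c \<le> digit_series H c (G 1)"
  proof (rule G.sup_le)
    fix v assume v: "v \<in> {0..<G 1}"
    let ?A = "{p. 0 \<le> fst p \<and> fst p \<le> snd p \<and> fst p < G 1 \<and> snd p < H 1}"
    let ?f = "\<lambda>p. digit_series G c (fst p) - digit_series H c (snd p)"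
    have "?f (v, v) \<le> 0 / (1 - 1 / c)"
    proof (rule contraction_upper_bound[where A = ?A and f = ?f])
      show "bdd_above (?f ` ?A)"
      proof (rule bdd_aboveI2)
        fix p :: "real \<times> real" assume "p \<in> ?A"
        then show "?f p \<le> G 1 / (c - 1)"
          using G.series_le[OF c(1), of "fst p"] H.series_nonneg[OF c(1), of "snd p"] by auto
      qed
      fix p :: "real \<times> real" assume p: "p \<in> ?A"
      obtain x y where xy: "p = (x, y)" by force
      have in_x: "x \<in> {0..<G 1}" and in_y: "y \<in> {0..<H 1}" and xley: "x \<le> y" using p xy by auto
      let ?x = "floor_map G x" and ?y = "floor_map H y"
      have e: "?f p = (of_int \<lfloor>x\<rfloor> - of_int \<lfloor>y\<rfloor> + (digit_series G c ?x - digit_series H c ?y)) / c"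
        using G.series_eq[OF c(1) in_x] H.series_eq[OF c(1) in_y]
        by (simp add: xy diff_divide_distrib add_divide_distrib)
      show "\<exists>q\<in>?A. ?f p \<le> 0 + 1 / c * ?f q"
      proof (cases "\<lfloor>x\<rfloor> = \<lfloor>y\<rfloor>")
        case True
        have "?x \<le> floor_map H x" using le[of "frac x"] frac_lt_1[of x] by (simp add: floor_map_def)
        also have "\<dots> \<le> ?y" using H.tau_le[OF xley True] .
        finally have "(?x, ?y) \<in> ?A" using G.tau_range H.tau_range by auto
        then show ?thesis using e True by (intro bexI[of _ "(?x, ?y)"]) auto
      next
        case False
        then have "\<lfloor>x\<rfloor> + 1 \<le> \<lfloor>y\<rfloor>" using floor_mono[OF xley] by linarith
        then have "of_int \<lfloor>x\<rfloor> - of_int \<lfloor>y\<rfloor> \<le> (-1::real)" by linarith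
        moreover have x_in: "?x \<in> {0..<H 1}" using G.tau_in[of x] less by auto
        ultimately have "of_int \<lfloor>x\<rfloor> - of_int \<lfloor>y\<rfloor> + (digit_series G c ?x - digit_series H c ?y)
            \<le> digit_series G c ?x - digit_series H c ?x"
          using H.series_le_1[OF c x_in] H.series_nonneg[OF c(1) H.tau_in, of y] by linarith
        then have "?f p \<le> (digit_series G c ?x - digit_series H c ?x) / c"
          unfolding e using c by (intro divide_right_mono) auto
        then show ?thesis using x_in G.tau_in[of x] by (intro bexI[of _ "(?x, ?x)"]) auto
      qed
    qed (use v less c in auto)
    moreover have "digit_series H c v \<le> digit_series H c (G 1)"
      using v less by (intro H.series_mono[OF c]) auto
    ultimately show "digit_series G c v \<le> digit_series H c (G 1)" by simp
  qed
  also have "\<dots> < 1" using less G.G1_gt_1 by (intro H.series_less_1[OF c]) auto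
  finally have "c * digit_sup G c < c" using c by simp
  moreover have "b \<le> c * digit_sup G c" using G.sup_scale[OF c(1) cb] b by simp
  ultimately show False using cb by linarith
qed

context expanding_branch begin

text \<open>The conjugacy for \<open>G\<close>, continued continuously beyond \<open>G 1\<close>, is compared with the digit series of
\<open>H\<close> in the same base. It satisfies the equation for \<open>H\<close> up to an error that is uniformly small,
and the contraction principle converts this into closeness of the two functions. Digit sequences
themselves need not be close, so the comparison is between values only.\<close>

lemma sup_near_1:
  assumes b: "1 < b" "digit_sup G b = 1" and "0 < e"
  obtains d where "0 < d"
    and "\<And>H. expanding_branch H \<Longrightarrow> (\<And>u. u \<in> {0..1} \<Longrightarrow> \<bar>H u - G u\<bar> \<le> d) \<Longrightarrow> \<bar>digit_sup H b - 1\<bar> \<le> e"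
proof -
  let ?S = "digit_series G b"
  define N where "N = G 1"
  have N1: "1 < N" using G1_gt_1 N_def by simp
  \<comment> \<open>The affine continuation by slope one keeps \<open>P\<close> a monotone bijection between intervals, which
      gives its continuity at \<open>N\<close> together with that at all other points.\<close>
  define P where "P v = (if v < N then ?S v else 1 + (v - N))" for v
  have P_cont: "continuous_on {0..<N+2} P"
  proof (rule mono_onto_imp_continuous_on)
    show "mono_on {0..<N+2} P"
    proof (rule mono_onI)
      fix r s assume "r \<in> {0..<N+2}" "s \<in> {0..<N+2}" "r \<le> s"
      then show "P r \<le> P s"
        using series_mono[OF b, of r s] series_le_1[OF b, of r] by (auto simp: P_def N_def)
    qed
    show "P ` {0..<N+2} = {0..<3}"
    proof (intro equalityI subsetI)
      fix y assume "y \<in> P ` {0..<N+2}"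
      then obtain x where x: "0 \<le> x" "x < N + 2" "y = P x" by auto
      then show "y \<in> {0..<3}"
        using series_le_1[OF b, of x] series_nonneg[OF b(1), of x] by (auto simp: P_def N_def)
    next
      fix y :: real assume y: "y \<in> {0..<3}"
      show "y \<in> P ` {0..<N+2}"
      proof (cases "y < 1")
        case True
        then have "y \<in> ?S ` {0..<G 1}" using series_onto[OF b] y by auto
        then obtain v where "v \<in> {0..<N}" "y = ?S v" unfolding N_def by blast
        then show ?thesis by (intro image_eqI[of _ _ v]) (auto simp: P_def)
      next
        case False
        then show ?thesis using y N1 by (intro image_eqI[of _ _ "N + (y - 1)"]) (auto simp: P_def)
      qed
    qed
  qed (use N1 in auto)
  have PG_cont: "continuous_on {of_int k..of_int k + 1} (\<lambda>v. P (G (v - of_int k)))" for k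
  proof (rule continuous_on_compose2[OF P_cont])
    show "continuous_on {of_int k..of_int k + 1} (\<lambda>v. G (v - of_int k))"
      by (rule continuous_on_compose2[OF G_cont]) (auto intro!: continuous_intros)
    show "(\<lambda>v. G (v - of_int k)) ` {of_int k..of_int k + 1} \<subseteq> {0..<N+2}"
    proof (rule image_subsetI)
      fix v :: real assume "v \<in> {of_int k..of_int k + 1}"
      then show "G (v - of_int k) \<in> {0..<N+2}"
        using G_le[of 0 "v - of_int k"] G_le[of "v - of_int k" 1] by (simp add: N_def)
    qed
  qed
  define E where "E v = (of_int \<lfloor>v\<rfloor> + P (\<tau> v)) / b" for v
  have E_eq: "E v = P v" if "0 \<le> v" "v < N" for v
    using that series_eq[OF b(1), of v] tau_range[of v] by (simp add: E_def P_def N_def)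
  \<comment> \<open>Taking the unit interval that ends at or after \<open>N\<close> treats an integral \<open>N\<close> like any other.\<close>
  have E_N: "E N = 1"
  proof -
    define k where "k = \<lceil>N\<rceil> - 1"
    have k: "0 \<le> k" "of_int k < N" "N \<le> of_int k + 1" using N1 by (auto simp: k_def) linarith
    let ?g = "\<lambda>v. (of_int k + P (G (v - of_int k))) / b - P v"
    have "?g N = 0"
    proof (rule continuous_constant_on_closure[where S = "{of_int k..<N}" and f = ?g and x = N and a = 0])
      have cl: "closure {of_int k..<N} = {of_int k..N}" using k by simp
      show "continuous_on (closure {of_int k..<N}) ?g"
        unfolding cl using k b(1)
        by (intro continuous_intros continuous_on_subset[OF PG_cont] continuous_on_subset[OF P_cont]) auto
      show "N \<in> closure {of_int k..<N}" unfolding cl using k by simp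
      show "?g v = 0" if v: "v \<in> {of_int k..<N}" for v
      proof -
        have "\<lfloor>v\<rfloor> = k" using v k by (intro floor_unique) auto
        then show ?thesis using E_eq[of v] v k by (auto simp: E_def tau_floor_eq)
      qed
    qed
    then have g: "(of_int k + P (G (N - of_int k))) / b = 1" by (simp add: P_def)
    show ?thesis
    proof (cases "N = of_int k + 1")
      case True
      then have "\<lfloor>N\<rfloor> = k + 1" by (metis floor_of_int of_int_1 of_int_add)
      moreover have "(of_int k + 1) / b = 1" using g True by (simp add: P_def N_def[symmetric])
      moreover have "\<tau> N = 0" using True tau_eq_0_iff[of N] by simp
      ultimately show ?thesis using series_0 N1 by (simp add: E_def P_def)
    next
      case False
      then have "\<lfloor>N\<rfloor> = k" using k by (intro floor_unique) auto
      then show ?thesis using g by (simp add: E_def tau_floor_eq)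
    qed
  qed
  \<comment> \<open>The error per step is \<open>3 \<epsilon>\<close>, hence \<open>3 \<epsilon> K\<close> in total; another \<open>\<epsilon>\<close> is lost because \<open>P\<close> has
      supremum \<open>1\<close> only up to \<open>\<epsilon>\<close> on the domain of the perturbed map.\<close>
  define K where "K = 1 / (1 - 1 / b)"
  have K: "0 < K" using b by (simp add: K_def)
  define \<epsilon> where "\<epsilon> = e / (1 + 3 * K)"
  have \<epsilon>: "0 < \<epsilon>" "\<epsilon> * (1 + 3 * K) = e" using K \<open>0 < e\<close> by (auto simp: \<epsilon>_def)
  have "uniformly_continuous_on {0..N+1} P"
    by (intro compact_uniformly_continuous continuous_on_subset[OF P_cont]) auto
  then obtain d1 where d1: "0 < d1"
    "\<And>x y. x \<in> {0..N+1} \<Longrightarrow> y \<in> {0..N+1} \<Longrightarrow> \<bar>x - y\<bar> < d1 \<Longrightarrow> \<bar>P x - P y\<bar> < \<epsilon>"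
    unfolding uniformly_continuous_on_def dist_real_def using \<epsilon>(1) by metis
  obtain d2 where d2: "0 < d2" "\<And>v. N \<le> v \<Longrightarrow> v < N + d2 \<Longrightarrow> \<bar>E v - 1\<bar> < \<epsilon>"
  proof -
    define k where "k = \<lfloor>N\<rfloor>"
    have k: "of_int k \<le> N" "N < of_int k + 1" by (auto simp: k_def)
    have "continuous_on {of_int k..of_int k + 1} (\<lambda>v. (of_int k + P (G (v - of_int k))) / b)"
      using b(1) by (intro continuous_intros PG_cont) auto
    then obtain d where d: "0 < d" "\<And>v. v \<in> {of_int k..of_int k + 1} \<Longrightarrow> \<bar>v - N\<bar> < d \<Longrightarrow>
        \<bar>(of_int k + P (G (v - of_int k))) / b - (of_int k + P (G (N - of_int k))) / b\<bar> < \<epsilon>"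
      using k \<epsilon>(1) unfolding continuous_on_iff dist_real_def by (metis atLeastAtMost_iff less_imp_le)
    have E_k: "E v = (of_int k + P (G (v - of_int k))) / b" if "N \<le> v" "v < of_int k + 1" for v
    proof -
      have "\<lfloor>v\<rfloor> = k" using that k by (intro floor_unique) auto
      then show ?thesis by (simp add: E_def tau_floor_eq)
    qed
    show ?thesis
    proof (rule that[of "min d (of_int k + 1 - N)"])
      show "0 < min d (of_int k + 1 - N)" using d k by simp
      fix v assume v: "N \<le> v" "v < N + min d (of_int k + 1 - N)"
      then have "v < of_int k + 1" "v < N + d" by auto
      then show "\<bar>E v - 1\<bar> < \<epsilon>" using d(2)[of v] E_k[of v] E_k[of N] k v E_N by auto
    qed
  qed
  obtain v0 where v0: "0 \<le> v0" "v0 < N" "1 - \<epsilon> < ?S v0"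
    using series_gt[OF b, of "1 - \<epsilon>"] \<epsilon>(1) unfolding N_def by auto
  define d where "d = min (min (d1 / 2) (d2 / 2)) (min (min ((N - v0) / 2) 1) \<epsilon>)"
  have d: "0 < d" "d < d1" "d < d2" "d < N - v0" "d \<le> 1" "d \<le> \<epsilon>"
    using d1(1) d2(1) v0 \<epsilon>(1) by (auto simp: d_def min_def)
  show ?thesis
  proof (rule that[OF d(1)])
    fix H assume "expanding_branch H" and near: "\<And>u. u \<in> {0..1} \<Longrightarrow> \<bar>H u - G u\<bar> \<le> d"
    interpret H: expanding_branch H by fact
    have H1: "\<bar>H 1 - N\<bar> \<le> d" using near[of 1] by (simp add: N_def)
    let ?f = "\<lambda>v. \<bar>digit_series H b v - P v\<bar>"
    have f_le: "?f v \<le> 3 * \<epsilon> * K" if v: "v \<in> {0..<H 1}" for v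
    proof -
      have "?f v \<le> 3 * \<epsilon> / (1 - 1 / b)"
      proof (rule contraction_upper_bound[where A = "{0..<H 1}" and f = ?f])
        have P_bound: "0 \<le> P x \<and> P x \<le> 2" if "x \<in> {0..<H 1}" for x
          using that H1 d(5) series_le_1[OF b, of x] series_nonneg[OF b(1), of x] by (auto simp: P_def N_def)
        show "bdd_above (?f ` {0..<H 1})"
        proof (rule bdd_aboveI2)
          fix x assume x: "x \<in> {0..<H 1}"
          show "?f x \<le> H 1 / (b - 1) + 2"
            using P_bound[OF x] H.series_le[OF b(1) x] H.series_nonneg[OF b(1) x] by auto
        qed
        fix x assume x: "x \<in> {0..<H 1}"
        have EP: "\<bar>E x - P x\<bar> \<le> 2 * \<epsilon>"
        proof (cases "x < N")
          case True
          then show ?thesis using E_eq[of x] x \<epsilon>(1) by simp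
        next
          case False
          then have "\<bar>E x - 1\<bar> < \<epsilon>" using d2(2)[of x] x H1 d by auto
          moreover have "\<bar>P x - 1\<bar> \<le> \<epsilon>" using False x H1 d by (auto simp: P_def)
          ultimately show ?thesis by linarith
        qed
        have PP: "\<bar>P (\<tau> x) - P (floor_map H x)\<bar> < \<epsilon>"
        proof (rule d1(2))
          show "\<tau> x \<in> {0..N + 1}" using tau_range[of x] by (simp add: N_def)
          show "floor_map H x \<in> {0..N + 1}" using H.tau_range[of x] H1 d(5) by auto
          show "\<bar>\<tau> x - floor_map H x\<bar> < d1"
            using near[of "frac x"] frac_lt_1[of x] d by (simp add: floor_map_def abs_minus_commute)
        qed
        have "\<bar>digit_series H b x - E x\<bar> = \<bar>digit_series H b (floor_map H x) - P (\<tau> x)\<bar> / b"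
          using H.series_eq[OF b(1) x] b(1)
          by (simp add: E_def diff_divide_distrib[symmetric])
        also have "\<dots> \<le> (\<epsilon> + ?f (floor_map H x)) / b"
          using PP b(1) by (intro divide_right_mono) auto
        also have "\<dots> \<le> \<epsilon> + 1 / b * ?f (floor_map H x)"
          using b(1) \<epsilon>(1) unfolding add_divide_distrib by (simp add: pos_divide_le_eq)
        finally have "?f x \<le> 3 * \<epsilon> + 1 / b * ?f (floor_map H x)" using EP by linarith
        then show "\<exists>y\<in>{0..<H 1}. ?f x \<le> 3 * \<epsilon> + 1 / b * ?f y" using H.tau_in[of x] by blast
      qed (use b v in auto)
      then show ?thesis by (simp add: K_def)
    qed
    have "digit_sup H b \<le> 1 + e"
    proof (rule H.sup_le)
      fix v assume v: "v \<in> {0..<H 1}"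
      have "P v \<le> 1 + \<epsilon>" using v H1 d series_le_1[OF b, of v] \<epsilon>(1) by (auto simp: P_def N_def)
      then show "digit_series H b v \<le> 1 + e" using f_le[OF v] \<epsilon>(2) by (auto simp: algebra_simps)
    qed
    moreover have "1 - e \<le> digit_sup H b"
    proof -
      have v: "v0 \<in> {0..<H 1}" using v0 H1 d by auto
      have "P v0 = ?S v0" using v0 by (simp add: P_def)
      then have "1 - e \<le> digit_series H b v0" using f_le[OF v] v0 \<epsilon>(2) by (auto simp: algebra_simps)
      then show ?thesis using H.series_le_sup[OF b(1) v] by linarith
    qed
    ultimately show "\<bar>digit_sup H b - 1\<bar> \<le> e" by linarith
  qed
qed

lemma sup_1_stable:
  assumes b: "1 < b" "digit_sup G b = 1" and "0 < e"
  obtains d where "0 < d"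
    and "\<And>H c. expanding_branch H \<Longrightarrow> (\<And>u. u \<in> {0..1} \<Longrightarrow> \<bar>H u - G u\<bar> \<le> d) \<Longrightarrow>
      1 < c \<Longrightarrow> digit_sup H c = 1 \<Longrightarrow> \<bar>c - b\<bar> \<le> e"
proof -
  have "0 < e / b" using b \<open>0 < e\<close> by simp
  then obtain d where d: "0 < d" "\<And>H. expanding_branch H \<Longrightarrow>
      (\<And>u. u \<in> {0..1} \<Longrightarrow> \<bar>H u - G u\<bar> \<le> d) \<Longrightarrow> \<bar>digit_sup H b - 1\<bar> \<le> e / b"
    using sup_near_1[OF b] by metis
  show ?thesis
  proof (rule that[OF d(1)])
    fix H c assume H: "expanding_branch H" and near: "\<And>u. u \<in> {0..1} \<Longrightarrow> \<bar>H u - G u\<bar> \<le> d"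
      and c: "1 < c" "digit_sup H c = 1"
    have "\<bar>digit_sup H b - 1\<bar> \<le> e / b" using d(2)[OF H near] .
    then have "b * \<bar>digit_sup H b - 1\<bar> \<le> e" using b by (simp add: field_simps)
    moreover have "b * \<bar>digit_sup H b - 1\<bar> = \<bar>b * digit_sup H b - b\<bar>"
      using b by (simp add: abs_mult_pos' right_diff_distrib)
    ultimately have *: "\<bar>b * digit_sup H b - b\<bar> \<le> e" by simp
    show "\<bar>c - b\<bar> \<le> e"
      using * expanding_branch.sup_scale[OF H, of b c] expanding_branch.sup_scale[OF H, of c b] b c
      by (cases "b \<le> c") auto
  qed
qed

end

section \<open>The branch in angular coordinates\<close>

definition arccot :: "real \<Rightarrow> real" where
  "arccot y = pi / 2 - arctan y"

lemma arccot_bounds: "0 < arccot y" "arccot y < pi"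
  using arctan_ubound[of y] arctan_lbound[of y] by (auto simp: arccot_def)

lemma arccot_cot: "0 < x \<Longrightarrow> x < pi \<Longrightarrow> arccot (cot x) = x"
  using arctan_tan[of "pi / 2 - x"] by (simp add: arccot_def tan_cot')

lemma cot_arccot: "cot (arccot y) = y"
  unfolding arccot_def using tan_cot'[of "pi / 2 - arctan y"] by (simp add: tan_arctan)

lemma arccot_less: "x < y \<Longrightarrow> arccot y < arccot x"
  by (simp add: arccot_def arctan_less_iff)

lemma arccot_le: "x \<le> y \<Longrightarrow> arccot y \<le> arccot x"
  by (simp add: arccot_def arctan_le_iff)

lemma arccot_diff_le:
  assumes "x \<le> y" shows "arccot x - arccot y \<le> y - x"
proof -
  have "arctan y - y \<le> arctan x - x"
  proof (rule DERIV_nonpos_imp_nonincreasing[OF assms])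
    fix z :: real
    have "((\<lambda>z. arctan z - z) has_real_derivative (inverse (1 + z\<^sup>2) - 1)) (at z)"
      by (auto intro!: derivative_eq_intros)
    moreover have "inverse (1 + z\<^sup>2) - 1 \<le> 0" by (simp add: inverse_le_1_iff)
    ultimately show "\<exists>y. DERIV (\<lambda>z. arctan z - z) z :> y \<and> y \<le> 0" by blast
  qed
  then show ?thesis by (simp add: arccot_def)
qed

lemma cot_less: "0 < x \<Longrightarrow> x < y \<Longrightarrow> y < pi \<Longrightarrow> cot y < cot x"
  using arccot_le[of "cot x" "cot y"] arccot_cot[of x] arccot_cot[of y] by (cases "cot y < cot x") auto

lemma has_real_derivative_cot [derivative_intros]:
  assumes "(g has_real_derivative D) (at x)" "sin (g x) \<noteq> 0"
  shows "((\<lambda>x. cot (g x)) has_real_derivative - inverse ((sin (g x))\<^sup>2) * D) (at x)"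
  using assms by (intro DERIV_chain2[OF DERIV_cot])

text \<open>This is minus the derivative of \<open>x * cot x\<close>. That it is non-negative and non-decreasing on the
interval from \<open>0\<close> to \<open>pi\<close> expresses that \<open>x * cot x\<close> is decreasing and concave there.\<close>

definition cot_slope :: "real \<Rightarrow> real" where
  "cot_slope x = x / (sin x)\<^sup>2 - cot x"

lemma x_cos_le_sin:
  assumes "0 \<le> x" "x \<le> pi" shows "x * cos x \<le> sin (x::real)"
proof -
  have "sin 0 - 0 * cos 0 \<le> sin x - x * cos x"
  proof (rule DERIV_nonneg_imp_nondecreasing[OF assms(1)])
    fix z assume z: "0 \<le> z" "z \<le> x"
    have "((\<lambda>z. sin z - z * cos z) has_real_derivative z * sin z) (at z)"
      by (auto intro!: derivative_eq_intros)
    moreover have "0 \<le> z * sin z" using z assms by (auto intro!: mult_nonneg_nonneg sin_ge_zero)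
    ultimately show "\<exists>y. DERIV (\<lambda>z. sin z - z * cos z) z :> y \<and> 0 \<le> y" by blast
  qed
  then show ?thesis by simp
qed

lemma cot_slope_nonneg:
  assumes "0 < x" "x < pi" shows "0 \<le> cot_slope x"
proof -
  have s: "0 < sin x" using assms by (rule sin_gt_zero)
  have "sin x * cos x \<le> sin x * 1" using s by (intro mult_left_mono) auto
  also have "\<dots> \<le> x" using sin_x_le_x[of x] assms by simp
  finally have "cos x * sin x \<le> x" by (simp add: mult.commute)
  moreover have "cot_slope x = (x - cos x * sin x) / (sin x)\<^sup>2"
    using s by (simp add: cot_slope_def cot_def power2_eq_square field_simps)
  ultimately show ?thesis by simp
qed

lemma cot_slope_mono:
  assumes "0 < x" "x \<le> y" "y < pi" shows "cot_slope x \<le> cot_slope y"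
proof (rule DERIV_nonneg_imp_nondecreasing[OF assms(2)])
  fix z assume z: "x \<le> z" "z \<le> y"
  have s: "0 < sin z" using z assms by (intro sin_gt_zero) auto
  have "(cot_slope has_real_derivative 2 * (sin z - z * cos z) / (sin z) ^ 3) (at z)"
    unfolding cot_slope_def using s
    by (auto intro!: derivative_eq_intros simp: field_simps power2_eq_square power3_eq_cube)
  moreover have "0 \<le> 2 * (sin z - z * cos z) / (sin z) ^ 3"
    using x_cos_le_sin[of z] z assms s by auto
  ultimately show "\<exists>d. DERIV cot_slope z :> d \<and> 0 \<le> d" by blast
qed

lemma DERIV_scaled_cot:
  assumes "sin (t * a) \<noteq> 0"
  shows "((\<lambda>t. t * cot (t * a)) has_real_derivative - cot_slope (t * a)) (at t)"
  unfolding cot_slope_def using assms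
  by (auto intro!: derivative_eq_intros simp: field_simps)

text \<open>For \<open>lam = 2 * cos \<theta>\<close> this is the inverse of the parabolic map \<open>h_zero lam\<close> in the coordinate
\<open>angle_coord \<theta>\<close> introduced below. The case distinction gives the limit value at \<open>0\<close>, where the
cotangent has its pole.\<close>

definition angle_branch :: "real \<Rightarrow> real \<Rightarrow> real" where
  "angle_branch \<theta> u = (if u \<le> 0 then 0 else arccot (cot (\<theta> * u) - 2 * cot \<theta>) / \<theta>)"

context
  fixes \<theta> :: real
  assumes \<theta>_pos: "0 < \<theta>" and \<theta>_less: "\<theta> < pi / 2"
begin

lemma cot_theta_pos: "0 < cot \<theta>" using \<theta>_pos \<theta>_less by (rule cot_gt_zero)

lemma angle_branch_pos: "0 < u \<Longrightarrow> 0 < angle_branch \<theta> u"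
  using arccot_bounds \<theta>_pos by (simp add: angle_branch_def)

lemma cot_angle_branch: "0 < u \<Longrightarrow> cot (\<theta> * angle_branch \<theta> u) = cot (\<theta> * u) - 2 * cot \<theta>"
  using \<theta>_pos by (simp add: angle_branch_def cot_arccot)

lemma angle_branch_1: "angle_branch \<theta> 1 = pi / \<theta> - 1"
proof -
  have "cot \<theta> - 2 * cot \<theta> = cot (pi - \<theta>)" by (simp add: cot_def)
  moreover have "arccot (cot (pi - \<theta>)) = pi - \<theta>" using \<theta>_pos \<theta>_less by (intro arccot_cot) auto
  ultimately show ?thesis using \<theta>_pos by (simp add: angle_branch_def diff_divide_distrib)
qed

lemma DERIV_angle_branch:
  assumes "0 < u" "u \<le> 1"
  shows "(angle_branch \<theta> has_real_derivative
      (1 + (cot (\<theta> * u))\<^sup>2) / (1 + (cot (\<theta> * u) - 2 * cot \<theta>)\<^sup>2)) (at u)"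
proof -
  have "\<theta> * u \<le> \<theta>" using assms \<theta>_pos by simp
  then have s: "0 < sin (\<theta> * u)" using assms \<theta>_pos \<theta>_less by (intro sin_gt_zero) (simp, linarith)
  then have e: "inverse ((sin (\<theta> * u))\<^sup>2) = 1 + (cot (\<theta> * u))\<^sup>2"
    using sin_cos_squared_add[of "\<theta> * u"] by (simp add: cot_def field_simps)
  have "((\<lambda>u. \<theta> * u) has_real_derivative \<theta>) (at u)" by (auto intro!: derivative_eq_intros)
  then have "((\<lambda>u. cot (\<theta> * u) - 2 * cot \<theta>) has_real_derivative
      - (1 + (cot (\<theta> * u))\<^sup>2) * \<theta> - 0) (at u)"
    unfolding e[symmetric] using s by (intro DERIV_diff DERIV_const has_real_derivative_cot) auto
  then have "((\<lambda>u. arccot (cot (\<theta> * u) - 2 * cot \<theta>) / \<theta>) has_real_derivative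
      (0 - inverse (1 + (cot (\<theta> * u) - 2 * cot \<theta>)\<^sup>2) * (- (1 + (cot (\<theta> * u))\<^sup>2) * \<theta> - 0)) / \<theta>) (at u)"
    unfolding arccot_def
    by (rule DERIV_cdivide[OF DERIV_diff[OF DERIV_const DERIV_chain2[OF DERIV_arctan]]])
  then have "((\<lambda>u. arccot (cot (\<theta> * u) - 2 * cot \<theta>) / \<theta>) has_real_derivative
      (1 + (cot (\<theta> * u))\<^sup>2) / (1 + (cot (\<theta> * u) - 2 * cot \<theta>)\<^sup>2)) (at u)"
  proof (rule DERIV_cong)
    have "(0 - inverse B * (- A * \<theta> - 0)) / \<theta> = A / B" for A B :: real
      using \<theta>_pos by (simp add: field_simps)
    then show "(0 - inverse (1 + (cot (\<theta> * u) - 2 * cot \<theta>)\<^sup>2) * (- (1 + (cot (\<theta> * u))\<^sup>2) * \<theta> - 0)) / \<theta> =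
      (1 + (cot (\<theta> * u))\<^sup>2) / (1 + (cot (\<theta> * u) - 2 * cot \<theta>)\<^sup>2)" .
  qed
  then show ?thesis
    using assms by (rule_tac has_field_derivative_transform_within_open[where S = "{0<..}"])
      (auto simp: angle_branch_def)
qed

lemma angle_branch_continuous: "continuous_on {0..1} (angle_branch \<theta>)"
  unfolding continuous_on_eq_continuous_within
proof
  fix x :: real assume x: "x \<in> {0..1}"
  show "continuous (at x within {0..1}) (angle_branch \<theta>)"
  proof (cases "x = 0")
    case False
    then have "isCont (angle_branch \<theta>) x" using DERIV_angle_branch[of x] x by (auto intro: DERIV_isCont)
    then show ?thesis by (rule continuous_at_imp_continuous_at_within)
  next
    case True
    show ?thesis unfolding True continuous_within_eps_delta
    proof (intro allI impI)
      fix e :: real assume e: "0 < e"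
      define f where "f = min (\<theta> * e) (pi / 2)"
      have f: "0 < f" "f < pi" "f \<le> \<theta> * e" using e \<theta>_pos pi_gt_zero unfolding f_def by (simp, linarith, simp)
      define d where "d = arccot (cot f + 2 * cot \<theta>) / \<theta>"
      have d: "0 < d" using arccot_bounds \<theta>_pos by (simp add: d_def)
      have "angle_branch \<theta> u < e" if "0 < u" "u < d" for u
      proof -
        have "\<theta> * u < arccot (cot f + 2 * cot \<theta>)" using that \<theta>_pos by (simp add: d_def field_simps)
        then have "cot f + 2 * cot \<theta> < cot (\<theta> * u)"
          using cot_less[of "\<theta> * u" "arccot (cot f + 2 * cot \<theta>)"] that \<theta>_pos arccot_bounds
          by (simp add: cot_arccot)
        then have "arccot (cot (\<theta> * u) - 2 * cot \<theta>) < f"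
          using arccot_less[of "cot f" "cot (\<theta> * u) - 2 * cot \<theta>"] arccot_cot[of f] f by simp
        then show ?thesis using f that \<theta>_pos by (simp add: angle_branch_def field_simps)
      qed
      then have "\<bar>angle_branch \<theta> u\<bar> < e" if "0 \<le> u" "u < d" for u
        using that e angle_branch_pos[of u] by (cases "u = 0") (simp_all add: angle_branch_def[of _ 0])
      then show "\<exists>d>0. \<forall>x'\<in>{0..1}. dist x' 0 < d \<longrightarrow> dist (angle_branch \<theta> x') (angle_branch \<theta> 0) < e"
        using d by (intro exI[of _ d]) (simp add: dist_real_def angle_branch_def[of _ 0])
    qed
  qed
qed

text \<open>With \<open>A = cot (\<theta> u)\<close> and \<open>C = cot \<theta>\<close> the slope is \<open>(1 + A^2) / (1 + (A - 2 C)^2)\<close>. It exceeds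
\<open>1\<close> exactly when \<open>A > C\<close>, that is, for \<open>u < 1\<close>.\<close>

lemma expanding_angle_branch: "expanding_branch (angle_branch \<theta>)"
proof
  show "angle_branch \<theta> 0 = 0" by (simp add: angle_branch_def)
  show "continuous_on {0..1} (angle_branch \<theta>)" by (rule angle_branch_continuous)
  show "strict_mono_on {0..1} (\<lambda>u. angle_branch \<theta> u - u)"
  proof (rule strict_mono_onI)
    fix r s :: real assume rs: "r \<in> {0..1}" "s \<in> {0..1}" "r < s"
    show "angle_branch \<theta> r - r < angle_branch \<theta> s - s"
    proof (rule DERIV_pos_imp_increasing_open[OF rs(3)])
      show "continuous_on {r..s} (\<lambda>u. angle_branch \<theta> u - u)"
        using rs by (intro continuous_intros continuous_on_subset[OF angle_branch_continuous]) auto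
      fix u assume "r < u" "u < s"
      then have u: "0 < u" "u < 1" using rs by auto
      let ?A = "cot (\<theta> * u)" and ?B = "cot (\<theta> * u) - 2 * cot \<theta>"
      have "cot \<theta> < ?A" using u \<theta>_pos \<theta>_less by (intro cot_less) auto
      then have "\<bar>?B\<bar> < \<bar>?A\<bar>" using cot_theta_pos by auto
      then have "?B\<^sup>2 < ?A\<^sup>2" by (meson abs_le_square_iff not_le)
      then have "1 < (1 + ?A\<^sup>2) / (1 + ?B\<^sup>2)" by (simp add: add_pos_nonneg)
      moreover have "((\<lambda>u. angle_branch \<theta> u - u) has_real_derivative (1 + ?A\<^sup>2) / (1 + ?B\<^sup>2) - 1) (at u)"
        using u by (intro derivative_intros DERIV_angle_branch) auto
      ultimately show "\<exists>y. DERIV (\<lambda>u. angle_branch \<theta> u - u) u :> y \<and> 0 < y"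
        by (intro exI conjI) auto
    qed
  qed
qed

lemma angle_branch_near_id:
  assumes "0 \<le> u" "u \<le> 1"
  shows "angle_branch \<theta> u \<le> u + 2 * cot \<theta> / \<theta>"
proof (cases "u = 0")
  case True
  then show ?thesis using cot_theta_pos \<theta>_pos by (simp add: angle_branch_def)
next
  case False
  have "\<theta> * u \<le> \<theta>" using assms \<theta>_pos by simp
  then have "arccot (cot (\<theta> * u)) = \<theta> * u" using assms False \<theta>_pos \<theta>_less by (intro arccot_cot) (simp, linarith)
  then have "arccot (cot (\<theta> * u) - 2 * cot \<theta>) \<le> \<theta> * u + 2 * cot \<theta>"
    using arccot_diff_le[of "cot (\<theta> * u) - 2 * cot \<theta>" "cot (\<theta> * u)"] cot_theta_pos by simp
  then show ?thesis using False assms \<theta>_pos by (simp add: angle_branch_def field_simps)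
qed

text \<open>Fix the value \<open>g\<close> of the branch for \<open>\<theta>\<close> and let \<open>\<kappa> t\<close> be \<open>t\<close> times the defect of the equation
\<open>cot (t g) = cot (t u) - 2 cot t\<close>. The factor \<open>t\<close> turns every term into a multiple of some
\<open>x * cot x\<close>, so that the derivative of \<open>\<kappa>\<close> is a combination of values of \<open>cot_slope\<close> that is
non-negative and bounded. As \<open>\<kappa> \<theta> = 0\<close>, both the sign and the size of \<open>\<kappa> \<alpha>\<close> are known, and they
control the branch for \<open>\<alpha>\<close>.\<close>

lemma angle_branch_compare:
  assumes \<alpha>: "0 < \<alpha>" "\<alpha> \<le> \<theta>" and u: "0 < u" "u \<le> 1"
  shows "angle_branch \<theta> u \<le> angle_branch \<alpha> u"
    and "angle_branch \<alpha> u - angle_branch \<theta> u \<le> 3 * cot_slope (pi - \<theta>) / \<alpha>\<^sup>2 * (\<theta> - \<alpha>)"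
proof -
  interpret expanding_branch "angle_branch \<theta>" by (rule expanding_angle_branch)
  define g where "g = angle_branch \<theta> u"
  define g' where "g' = angle_branch \<alpha> u"
  define \<kappa> where "\<kappa> t = t * cot (t * u) - 2 * (t * cot (t * 1)) - t * cot (t * g)" for t
  have ug: "u \<le> g" using G_expands[of 0 u] u by (simp add: g_def)
  have "g \<le> pi / \<theta> - 1" using G_le[of u 1] u angle_branch_1 by (simp add: g_def)
  then have \<theta>g: "\<theta> * g \<le> pi - \<theta>" using \<theta>_pos by (simp add: field_simps)
  have g0: "0 < g" using ug u by simp
  have der: "(\<kappa> has_real_derivative (cot_slope (t * g) - cot_slope (t * u) + 2 * cot_slope t)) (at t)"
    and der_nonneg: "0 \<le> cot_slope (t * g) - cot_slope (t * u) + 2 * cot_slope t"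
    and der_le: "cot_slope (t * g) - cot_slope (t * u) + 2 * cot_slope t \<le> 3 * cot_slope (pi - \<theta>)"
    if t: "\<alpha> \<le> t" "t \<le> \<theta>" for t
  proof -
    have t0: "0 < t" using \<alpha> t by simp
    have tg: "t * g \<le> pi - \<theta>" using \<theta>g mult_right_mono[OF t(2), of g] g0 by linarith
    have tug: "t * u \<le> t * g" using t0 ug by simp
    have less_pi: "t * g < pi" "t < pi" using tg \<theta>_pos \<theta>_less t by auto
    then have tu_less: "t * u < pi" using tug by linarith
    have s: "sin (t * u) \<noteq> 0" "sin (t * g) \<noteq> 0" "sin t \<noteq> 0"
      using sin_gt_zero[of "t * u"] sin_gt_zero[of "t * g"] sin_gt_zero[of t] t0 u g0 tu_less less_pi by auto
    show "(\<kappa> has_real_derivative (cot_slope (t * g) - cot_slope (t * u) + 2 * cot_slope t)) (at t)"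
    proof -
      have "(\<kappa> has_real_derivative
          (- cot_slope (t * u) - 2 * (- cot_slope (t * 1)) - (- cot_slope (t * g)))) (at t)"
        unfolding \<kappa>_def using s by (intro DERIV_diff DERIV_cmult DERIV_scaled_cot) auto
      then show ?thesis by (simp add: algebra_simps)
    qed
    have r0: "0 \<le> cot_slope (t * u)" "0 \<le> cot_slope t"
      using t0 u tu_less less_pi by (auto intro!: cot_slope_nonneg)
    moreover have "cot_slope (t * u) \<le> cot_slope (t * g)"
      using t0 u tug less_pi by (intro cot_slope_mono) auto
    ultimately show "0 \<le> cot_slope (t * g) - cot_slope (t * u) + 2 * cot_slope t" by linarith
    have "cot_slope (t * g) \<le> cot_slope (pi - \<theta>)" "cot_slope t \<le> cot_slope (pi - \<theta>)"
      using t0 g0 tg t \<theta>_pos \<theta>_less by (auto intro!: cot_slope_mono)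
    with r0 show "cot_slope (t * g) - cot_slope (t * u) + 2 * cot_slope t \<le> 3 * cot_slope (pi - \<theta>)"
      by linarith
  qed
  have "\<kappa> \<theta> = \<theta> * (cot (\<theta> * u) - 2 * cot \<theta> - cot (\<theta> * g))" by (simp add: \<kappa>_def algebra_simps)
  then have "\<kappa> \<theta> = 0" using cot_angle_branch[OF u(1)] by (simp add: g_def)
  moreover have "\<kappa> \<alpha> \<le> \<kappa> \<theta>"
    by (rule DERIV_nonneg_imp_nondecreasing[OF \<alpha>(2)]) (use der der_nonneg in blast)
  moreover have "3 * cot_slope (pi - \<theta>) * \<alpha> - \<kappa> \<alpha> \<le> 3 * cot_slope (pi - \<theta>) * \<theta> - \<kappa> \<theta>"
  proof (rule DERIV_nonneg_imp_nondecreasing[OF \<alpha>(2)])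
    fix t assume t: "\<alpha> \<le> t" "t \<le> \<theta>"
    have "((\<lambda>t. 3 * cot_slope (pi - \<theta>) * t - \<kappa> t) has_real_derivative
        3 * cot_slope (pi - \<theta>) - (cot_slope (t * g) - cot_slope (t * u) + 2 * cot_slope t)) (at t)"
      using der[OF t] by (auto intro!: derivative_eq_intros)
    then show "\<exists>y. DERIV (\<lambda>t. 3 * cot_slope (pi - \<theta>) * t - \<kappa> t) t :> y \<and> 0 \<le> y"
      using der_le[OF t] by (intro exI conjI) auto
  qed
  ultimately have \<kappa>: "\<kappa> \<alpha> \<le> 0" "- \<kappa> \<alpha> \<le> 3 * cot_slope (pi - \<theta>) * (\<theta> - \<alpha>)"
    by (auto simp: algebra_simps)
  define A where "A = cot (\<alpha> * u) - 2 * cot \<alpha>"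
  have \<kappa>A: "\<kappa> \<alpha> = \<alpha> * (A - cot (\<alpha> * g))" by (simp add: \<kappa>_def A_def algebra_simps)
  have le: "A \<le> cot (\<alpha> * g)" using \<kappa>(1) \<alpha> unfolding \<kappa>A by (simp add: mult_le_0_iff)
  have g'A: "\<alpha> * g' = arccot A" using \<alpha> u by (simp add: g'_def angle_branch_def A_def)
  have gA: "\<alpha> * g = arccot (cot (\<alpha> * g))"
  proof -
    have "\<alpha> * g \<le> \<theta> * g" using \<alpha> g0 by simp
    then have "\<alpha> * g < pi" using \<theta>g \<theta>_pos by linarith
    then show ?thesis using \<alpha> g0 by (subst arccot_cot) auto
  qed
  have "\<alpha> * g \<le> \<alpha> * g'" unfolding g'A using gA arccot_le[OF le] by linarith
  then show "angle_branch \<theta> u \<le> angle_branch \<alpha> u" using \<alpha> by (simp add: g_def g'_def)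
  have "\<alpha> * g' - \<alpha> * g \<le> cot (\<alpha> * g) - A" unfolding g'A using gA arccot_diff_le[OF le] by linarith
  then have "\<alpha> * (\<alpha> * g' - \<alpha> * g) \<le> \<alpha> * (cot (\<alpha> * g) - A)" using \<alpha> by (intro mult_left_mono) auto
  also have "\<dots> = - \<kappa> \<alpha>" by (simp add: \<kappa>A algebra_simps)
  also note \<kappa>(2)
  finally have "(g' - g) * \<alpha>\<^sup>2 \<le> 3 * cot_slope (pi - \<theta>) * (\<theta> - \<alpha>)"
    by (simp add: power2_eq_square algebra_simps)
  then have "g' - g \<le> 3 * cot_slope (pi - \<theta>) * (\<theta> - \<alpha>) / \<alpha>\<^sup>2" using \<alpha> by (simp add: pos_le_divide_eq)
  then show "angle_branch \<alpha> u - angle_branch \<theta> u \<le> 3 * cot_slope (pi - \<theta>) / \<alpha>\<^sup>2 * (\<theta> - \<alpha>)"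
    by (simp add: g_def g'_def)
qed

end

lemma angle_branch_uniform:
  assumes \<theta>: "0 < \<theta>" "\<theta> < pi / 2" and e: "0 < e"
  obtains d where "0 < d"
    and "\<And>\<alpha> u. 0 < \<alpha> \<Longrightarrow> \<alpha> < pi / 2 \<Longrightarrow> \<bar>\<alpha> - \<theta>\<bar> < d \<Longrightarrow> u \<in> {0..1} \<Longrightarrow>
      \<bar>angle_branch \<alpha> u - angle_branch \<theta> u\<bar> \<le> e"
proof -
  define r where "r = cot_slope (pi - \<theta> / 2)"
  define K where "K = 3 * r / (\<theta> / 2)\<^sup>2"
  have r0: "0 \<le> r" unfolding r_def using \<theta> by (intro cot_slope_nonneg) auto
  have K0: "0 \<le> K" using r0 by (simp add: K_def)
  have bound: "\<bar>angle_branch \<alpha> u - angle_branch \<beta> u\<bar> \<le> K * (\<beta> - \<alpha>)"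
    if "\<theta> / 2 \<le> \<alpha>" "\<alpha> \<le> \<beta>" "\<beta> < pi / 2" "u \<in> {0..1}" for \<alpha> \<beta> u
  proof (cases "u = 0")
    case True
    then show ?thesis using K0 that by (simp add: angle_branch_def)
  next
    case False
    have \<alpha>0: "0 < \<alpha>" and \<beta>0: "0 < \<beta>" using that \<theta> by auto
    note cmp = angle_branch_compare[OF \<beta>0 that(3) \<alpha>0 that(2), of u]
    have "cot_slope (pi - \<beta>) \<le> r"
      unfolding r_def using that \<theta> by (intro cot_slope_mono) auto
    moreover have "(\<theta> / 2)\<^sup>2 \<le> \<alpha>\<^sup>2" using that \<theta> by (intro power_mono) auto
    ultimately have "3 * cot_slope (pi - \<beta>) / \<alpha>\<^sup>2 \<le> K"
      unfolding K_def using \<theta> r0 that by (intro frac_le) auto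
    then have "3 * cot_slope (pi - \<beta>) / \<alpha>\<^sup>2 * (\<beta> - \<alpha>) \<le> K * (\<beta> - \<alpha>)"
      using that by (intro mult_right_mono) auto
    then show ?thesis using cmp that False by auto
  qed
  define d where "d = min (\<theta> / 2) (e / (K + 1))"
  have d: "0 < d" "d \<le> \<theta> / 2" "K * d \<le> e"
  proof -
    show "0 < d" "d \<le> \<theta> / 2" using \<theta> e K0 unfolding d_def by (simp, linarith)
    have "K * d \<le> K * (e / (K + 1))" using K0 by (intro mult_left_mono) (auto simp: d_def)
    also have "\<dots> \<le> e" using K0 e by (simp add: field_simps)
    finally show "K * d \<le> e" .
  qed
  show ?thesis
  proof (rule that[OF d(1)])
    fix \<alpha> u :: real assume \<alpha>: "0 < \<alpha>" "\<alpha> < pi / 2" "\<bar>\<alpha> - \<theta>\<bar> < d" and u: "u \<in> {0..1}"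
    have "\<bar>angle_branch \<alpha> u - angle_branch \<theta> u\<bar> \<le> K * \<bar>\<alpha> - \<theta>\<bar>"
      using bound[of \<alpha> \<theta> u] bound[of \<theta> \<alpha> u] \<alpha> u d \<theta> by (cases "\<alpha> \<le> \<theta>") (auto simp: abs_minus_commute)
    also have "\<dots> \<le> K * d" using K0 \<alpha> by (intro mult_left_mono) auto
    finally show "\<bar>angle_branch \<alpha> u - angle_branch \<theta> u\<bar> \<le> e" using d by simp
  qed
qed

section \<open>From the continued fraction map to the floor map\<close>

text \<open>The rotation by \<open>\<theta>\<close>, acting on angles \<open>\<theta> v\<close>, is the Moebius map \<open>h_map (2 * cos \<theta>)\<close> in the
coordinate \<open>x = sin (\<theta> v) / sin (\<theta> (v + 1))\<close>. Measuring angles in units of \<open>\<theta>\<close> moves the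
breakpoints \<open>m_pt\<close> to the integers, independently of the parameter.\<close>

definition angle_coord :: "real \<Rightarrow> real \<Rightarrow> real" where
  "angle_coord \<theta> v = sin (\<theta> * v) / sin (\<theta> * (v + 1))"

locale hecke_angle =
  fixes \<theta> lam :: real
  assumes \<theta>_pos: "0 < \<theta>" and \<theta>_less: "\<theta> < pi / 2" and lam_def: "lam = 2 * cos \<theta>"
begin

abbreviation "\<xi> \<equiv> angle_coord \<theta>"
abbreviation "G \<equiv> angle_branch \<theta>"

sublocale expanding_branch G by (rule expanding_angle_branch[OF \<theta>_pos \<theta>_less])

lemma G_1: "G 1 = pi / \<theta> - 1" by (rule angle_branch_1[OF \<theta>_pos \<theta>_less])

lemma less_G_1_iff: "v < G 1 \<longleftrightarrow> \<theta> * (v + 1) < pi"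
  using \<theta>_pos by (simp add: G_1 field_simps)

lemma sin_shift_pos: "0 \<le> v \<Longrightarrow> v < G 1 \<Longrightarrow> 0 < sin (\<theta> * (v + 1))"
  using \<theta>_pos by (intro sin_gt_zero) (auto simp: less_G_1_iff)

lemma coord_0: "\<xi> 0 = 0" by (simp add: angle_coord_def)

text \<open>This is the addition formula \<open>2 cos \<theta> sin p = sin (p + \<theta>) + sin (p - \<theta>)\<close>.\<close>

lemma h_map_coord:
  assumes "0 \<le> v" "v < G 1"
  shows "h_map lam (\<xi> v) = \<xi> (v + 1)"
proof -
  define p where "p = \<theta> * (v + 1)"
  have s: "0 < sin p" unfolding p_def using assms by (rule sin_shift_pos)
  have v: "\<theta> * v = p - \<theta>" "\<theta> * (v + 1 + 1) = p + \<theta>" "\<theta> * (v + 1) = p"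
    by (auto simp: p_def algebra_simps)
  have "lam - sin (p - \<theta>) / sin p = sin (p + \<theta>) / sin p"
    using s by (simp add: lam_def sin_add sin_diff field_simps)
  then have "lam - \<xi> v = sin (\<theta> * (v + 1 + 1)) / sin (\<theta> * (v + 1))"
    unfolding angle_coord_def v .
  then show ?thesis by (simp add: h_map_def angle_coord_def)
qed

lemma coord_strict_mono: "strict_mono_on {0..<G 1} \<xi>"
proof (rule strict_mono_onI)
  fix x y assume xy: "x \<in> {0..<G 1}" "y \<in> {0..<G 1}" "x < y"
  have sx: "0 < sin (\<theta> * (x + 1))" and sy: "0 < sin (\<theta> * (y + 1))"
    using xy sin_shift_pos by auto
  have "\<theta> * (y - x) \<le> \<theta> * (y + 1)" using xy \<theta>_pos by simp
  also have "\<dots> < pi" using xy less_G_1_iff by auto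
  finally have "0 < sin (\<theta> * (y - x))" using xy \<theta>_pos by (intro sin_gt_zero) auto
  moreover have "0 < sin \<theta>" using \<theta>_pos \<theta>_less by (intro sin_gt_zero) auto
  ultimately have "0 < sin \<theta> * sin (\<theta> * (y - x))" by simp
  also have "\<dots> = sin (\<theta> * y) * sin (\<theta> * (x + 1)) - sin (\<theta> * x) * sin (\<theta> * (y + 1))"
    by (simp add: distrib_left right_diff_distrib sin_add sin_diff algebra_simps)
  finally show "\<xi> x < \<xi> y" using sx sy by (simp add: angle_coord_def field_simps)
qed

lemma coord_less_iff: "x \<in> {0..<G 1} \<Longrightarrow> y \<in> {0..<G 1} \<Longrightarrow> \<xi> x < \<xi> y \<longleftrightarrow> x < y"
  using coord_strict_mono by (rule strict_mono_on_less)

lemma coord_le_iff: "x \<in> {0..<G 1} \<Longrightarrow> y \<in> {0..<G 1} \<Longrightarrow> \<xi> x \<le> \<xi> y \<longleftrightarrow> x \<le> y"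
  using coord_strict_mono by (rule strict_mono_on_less_eq)

lemma inverse_coord:
  assumes "0 < v" "v < G 1"
  shows "1 / \<xi> v = cos \<theta> + sin \<theta> * cot (\<theta> * v)"
proof -
  have "\<theta> * v < \<theta> * (v + 1)" using \<theta>_pos by simp
  then have "\<theta> * v < pi" using assms less_G_1_iff[of v] by linarith
  then have "0 < sin (\<theta> * v)" using assms \<theta>_pos by (intro sin_gt_zero) auto
  then show ?thesis by (simp add: angle_coord_def distrib_left sin_add cot_def field_simps)
qed

lemma coord_nonneg: "v \<in> {0..<G 1} \<Longrightarrow> 0 \<le> \<xi> v"
  using coord_le_iff[of 0 v] coord_0 by auto

lemma coord_pos: "0 < v \<Longrightarrow> v < G 1 \<Longrightarrow> 0 < \<xi> v"
  using coord_less_iff[of 0 v] coord_0 by auto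

lemma coord_onto: "\<xi> ` {0..<G 1} = {0..}"
proof (intro equalityI subsetI)
  fix x assume "x \<in> \<xi> ` {0..<G 1}"
  then show "x \<in> {0..}" using coord_nonneg by auto
next
  fix x :: real assume x: "x \<in> {0..}"
  show "x \<in> \<xi> ` {0..<G 1}"
  proof (cases "x = 0")
    case True
    then show ?thesis using coord_0 G1_gt_1 by (intro image_eqI[of _ _ 0]) auto
  next
    case False
    have s: "0 < sin \<theta>" using \<theta>_pos \<theta>_less by (intro sin_gt_zero) auto
    define p where "p = arccot ((1 / x - cos \<theta>) / sin \<theta>)"
    have "cot (pi - \<theta>) < (1 / x - cos \<theta>) / sin \<theta>"
      using s x False by (simp add: cot_def field_simps)
    then have "p < pi - \<theta>"
      using arccot_less[of "cot (pi - \<theta>)"] arccot_cot[of "pi - \<theta>"] \<theta>_pos \<theta>_less by (simp add: p_def)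
    then have v: "0 < p / \<theta>" "p / \<theta> < G 1"
      using arccot_bounds[of "(1 / x - cos \<theta>) / sin \<theta>"] \<theta>_pos by (auto simp: p_def G_1 field_simps)
    have "1 / \<xi> (p / \<theta>) = 1 / x"
      using inverse_coord[OF v] \<theta>_pos s by (simp add: p_def cot_arccot)
    then have "\<xi> (p / \<theta>) = x" by simp
    then show ?thesis using v by (intro image_eqI[of _ _ "p / \<theta>"]) auto
  qed
qed

lemma coord_homeomorphism: "\<exists>\<zeta>. homeomorphism {0..<G 1} {0..} \<xi> \<zeta>"
proof (rule homeomorphism_into_1d)
  show "continuous_on {0..<G 1} \<xi>"
    unfolding angle_coord_def using sin_shift_pos by (intro continuous_intros) force
  show "path_connected {0..<G 1}" by (simp add: convex_imp_path_connected)
qed (use coord_onto strict_mono_on_imp_inj_on[OF coord_strict_mono] in auto)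

text \<open>The pole \<open>lam\<close> of \<open>h_map lam\<close> lies one unit before the point at infinity. So the breakpoints stop
with the last integer below \<open>G 1\<close>, whether or not \<open>G 1\<close> is itself an integer.\<close>

lemma lam_coord: "lam = \<xi> (G 1 - 1)"
proof -
  have "\<theta> * (G 1 - 1) = pi - 2 * \<theta>" "\<theta> * (G 1 - 1 + 1) = pi - \<theta>"
    using \<theta>_pos by (auto simp: G_1 field_simps)
  moreover have "0 < sin \<theta>" using \<theta>_pos \<theta>_less by (intro sin_gt_zero) auto
  ultimately show ?thesis by (simp add: angle_coord_def lam_def sin_double)
qed

lemma m_pt_coord: "real k < G 1 \<Longrightarrow> m_pt lam k = \<xi> (real k)"
proof (induction k)
  case (Suc k)
  then show ?case using h_map_coord[of "real k"] by (simp add: add.commute)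
qed (simp add: coord_0)

lemma i_top_bounds: "real (i_top lam) < G 1" "G 1 \<le> real (i_top lam) + 1"
proof -
  define n where "n = nat (\<lceil>G 1\<rceil> - 1)"
  have n: "real n < G 1" "G 1 \<le> real n + 1" using G1_gt_1 by (auto simp: n_def) linarith
  have le_iff: "lam \<le> m_pt lam k \<longleftrightarrow> G 1 \<le> real k + 1" if "real k < G 1" for k
    using m_pt_coord[OF that] coord_le_iff[of "G 1 - 1" "real k"] G1_gt_1 that by (auto simp: lam_coord[symmetric])
  have "i_top lam = n"
    unfolding i_top_def
  proof (rule Least_equality)
    show "lam \<le> m_pt lam n" using le_iff n by simp
    fix k assume k: "lam \<le> m_pt lam k"
    show "n \<le> k"
    proof (rule ccontr)
      assume "\<not> n \<le> k"
      then have "real k + 1 \<le> real n" by linarith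
      then show False using le_iff[of k] k n by linarith
    qed
  qed
  then show "real (i_top lam) < G 1" "G 1 \<le> real (i_top lam) + 1" using n by auto
qed

lemma mem_I_part_iff:
  assumes "v \<in> {0..<G 1}" "i \<le> i_top lam"
  shows "\<xi> v \<in> I_part lam i \<longleftrightarrow> nat \<lfloor>v\<rfloor> = i"
proof -
  have i: "real i \<in> {0..<G 1}" using assms i_top_bounds(1) by auto
  have 1: "m_pt lam i \<le> \<xi> v \<longleftrightarrow> real i \<le> v"
    using m_pt_coord[of i] i coord_le_iff[OF i assms(1)] by simp
  have 2: "nat \<lfloor>v\<rfloor> = i \<longleftrightarrow> real i \<le> v \<and> v < real i + 1" using assms by (auto simp: nat_eq_iff2) linarith+
  show ?thesis
  proof (cases "i < i_top lam")
    case True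
    then have i': "real (Suc i) \<in> {0..<G 1}" using i_top_bounds(1) by auto
    have "\<xi> v < m_pt lam (Suc i) \<longleftrightarrow> v < real i + 1"
      using m_pt_coord[of "Suc i"] i' coord_less_iff[OF assms(1) i'] by (simp del: m_pt.simps add: add.commute)
    then show ?thesis using 1 2 True by (simp add: I_part_def del: m_pt.simps)
  next
    case False
    then show ?thesis using 1 2 assms i_top_bounds(2) by (auto simp: I_part_def)
  qed
qed

lemma part_index_coord:
  assumes "v \<in> {0..<G 1}"
  shows "part_index lam (\<xi> v) = nat \<lfloor>v\<rfloor>"
proof -
  have "real (nat \<lfloor>v\<rfloor>) \<le> v" using assms by simp
  then have "real (nat \<lfloor>v\<rfloor>) < real (i_top lam) + 1" using assms i_top_bounds(2) by auto
  then have "nat \<lfloor>v\<rfloor> \<le> i_top lam" by linarith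
  then show ?thesis unfolding part_index_def using mem_I_part_iff[OF assms] by (intro the_equality) auto
qed

text \<open>In terms of \<open>1 / x\<close> the map \<open>h_zero lam\<close> is the translation by \<open>lam\<close>, and \<open>1 / x\<close> is an affine
function of the cotangent of the angle with slope \<open>sin \<theta>\<close>; a translation by \<open>2 cos \<theta>\<close> of the
former is one by \<open>2 cot \<theta>\<close> of the latter.\<close>

lemma h_zero_coord:
  assumes u: "0 \<le> u" "u < 1"
  shows "h_zero lam (\<xi> (G u)) = \<xi> u"
proof (cases "u = 0")
  case True
  then show ?thesis by (simp add: coord_0 h_zero_def)
next
  case False
  let ?y = "\<xi> (G u)"
  have w: "0 < G u" "G u < G 1" using G_less[of 0 u] G_less[of u 1] u False by auto
  have y: "0 < ?y" using coord_pos[OF w] .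
  have "0 < sin \<theta>" using \<theta>_pos \<theta>_less by (intro sin_gt_zero) auto
  then have "1 / ?y = cos \<theta> + sin \<theta> * cot (\<theta> * u) - 2 * cos \<theta>"
    unfolding inverse_coord[OF w] using cot_angle_branch[OF \<theta>_pos \<theta>_less, of u] u False
    by (simp add: right_diff_distrib cot_def)
  also have "\<dots> = 1 / \<xi> u - lam" using inverse_coord[of u] u False G1_gt_1 by (simp add: lam_def)
  finally have "1 / \<xi> u = (lam * ?y + 1) / ?y" using y by (simp add: field_simps)
  then have "\<xi> u = ?y / (lam * ?y + 1)" by (metis divide_divide_eq_right inverse_divide inverse_eq_divide inverse_inverse_eq)
  then show ?thesis by (simp add: h_zero_def)
qed

lemma h_branch_coord:
  assumes u: "0 \<le> u" "u < 1"
  shows "u + real i < G 1 \<Longrightarrow> h_branch lam i (\<xi> (G u)) = \<xi> (u + real i)"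
proof (induction i)
  case 0
  then show ?case using h_zero_coord[OF u] by simp
next
  case (Suc i)
  then have "h_branch lam (Suc i) (\<xi> (G u)) = h_map lam (\<xi> (u + real i))" by simp
  also have "\<dots> = \<xi> (u + real i + 1)" using Suc.prems u by (intro h_map_coord) auto
  finally show ?case by (simp add: add_ac)
qed

lemma G_onto_coord:
  assumes "0 \<le> y"
  obtains u where "0 \<le> u" "u < 1" "y = \<xi> (G u)"
proof -
  have "y \<in> \<xi> ` {0..<G 1}" using coord_onto assms by auto
  then obtain w where w: "0 \<le> w" "w < G 1" "y = \<xi> w" by auto
  then show ?thesis using G_surj[of w] that by metis
qed

lemma coord_G_less_iff:
  assumes "0 \<le> u" "u < 1" "0 \<le> w" "w < 1"
  shows "\<xi> (G u) < \<xi> (G w) \<longleftrightarrow> u < w"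
  using coord_less_iff[of "G u" "G w"] G_bounds[of u] G_bounds[of w] assms G_less[of u w] G_le[of w u]
  by (cases "u < w") auto

lemma inj_on_h_branch:
  assumes "\<And>y. y \<in> D \<Longrightarrow> \<exists>u. 0 \<le> u \<and> u < 1 \<and> u + real i < G 1 \<and> y = \<xi> (G u)"
  shows "inj_on (h_branch lam i) D"
proof (rule inj_onI)
  fix y z assume yz: "y \<in> D" "z \<in> D" and eq: "h_branch lam i y = h_branch lam i z"
  obtain u where u: "0 \<le> u" "u < 1" "u + real i < G 1" "y = \<xi> (G u)" using assms yz by blast
  obtain w where w: "0 \<le> w" "w < 1" "w + real i < G 1" "z = \<xi> (G w)" using assms yz by blast
  have "\<xi> (u + real i) = \<xi> (w + real i)" using eq u w h_branch_coord by simp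
  then have "u + real i = w + real i"
    by (rule inj_onD[OF strict_mono_on_imp_inj_on[OF coord_strict_mono]]) (use u w in auto)
  then show "y = z" using u w by simp
qed

lemma inj_on_h_branch_full:
  assumes "i < i_top lam"
  shows "inj_on (h_branch lam i) {0..}"
proof (rule inj_on_h_branch)
  fix y :: real assume "y \<in> {0..}"
  then obtain u where "0 \<le> u" "u < 1" "y = \<xi> (G u)" using G_onto_coord by auto
  moreover have "real i + 1 \<le> real (i_top lam)" using assms by linarith
  ultimately show "\<exists>u. 0 \<le> u \<and> u < 1 \<and> u + real i < G 1 \<and> y = \<xi> (G u)"
    using i_top_bounds(1) by (intro exI[of _ u]) auto
qed

text \<open>The last branch is cut off where \<open>u + i\<close> reaches \<open>G 1\<close>, and the two cases in \<open>last_domain\<close> are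
\<open>G 1\<close> non-integral and integral. In this form all branches can be treated alike.\<close>

lemma branch_domain_coord:
  assumes "i \<le> i_top lam"
  shows "branch_domain lam i = (\<lambda>u. \<xi> (G u)) ` {u. 0 \<le> u \<and> u < 1 \<and> u + real i < G 1}"
proof -
  have full: "{0..} = (\<lambda>u. \<xi> (G u)) ` {u. 0 \<le> u \<and> u < 1 \<and> u + real i < G 1}"
    if "real i + 1 \<le> G 1"
  proof (intro equalityI subsetI)
    fix y :: real assume "y \<in> {0..}"
    then obtain u where "0 \<le> u" "u < 1" "y = \<xi> (G u)" using G_onto_coord by auto
    then show "y \<in> (\<lambda>u. \<xi> (G u)) ` {u. 0 \<le> u \<and> u < 1 \<and> u + real i < G 1}"
      using that by (intro image_eqI[of _ _ u]) auto
  next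
    fix y assume "y \<in> (\<lambda>u. \<xi> (G u)) ` {u. 0 \<le> u \<and> u < 1 \<and> u + real i < G 1}"
    then obtain u where "0 \<le> u" "u < 1" "y = \<xi> (G u)" by auto
    then show "y \<in> {0..}" using coord_nonneg[of "G u"] G_bounds[of u] by auto
  qed
  show ?thesis
  proof (cases "i < i_top lam")
    case True
    then have "real i + 1 \<le> real (i_top lam)" by linarith
    then show ?thesis using full i_top_bounds(1) True by (simp add: branch_domain_def)
  next
    case False
    then have i: "i = i_top lam" using assms by simp
    have top: "real i < G 1" "G 1 \<le> real i + 1" using i_top_bounds i by auto
    have i_pos: "0 < i" using top G1_gt_1 by (cases i) auto
    have m: "m_pt lam i > lam \<longleftrightarrow> G 1 < real i + 1"
      using m_pt_coord[OF top(1)] coord_less_iff[of "G 1 - 1" "real i"] top G1_gt_1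
      by (auto simp: lam_coord[symmetric])
    show ?thesis
    proof (cases "G 1 < real i + 1")
      case False
      then show ?thesis using full m i by (simp add: branch_domain_def last_domain_def)
    next
      case True
      define u0 where "u0 = G 1 - real i"
      have u0: "0 \<le> u0" "u0 < 1" using True top by (auto simp: u0_def)
      have "inv_into {0..} (h_branch lam (i - 1)) lam = \<xi> (G u0)"
      proof (rule inv_into_f_eq)
        show "inj_on (h_branch lam (i - 1)) {0..}" using i i_pos by (intro inj_on_h_branch_full) auto
        show "\<xi> (G u0) \<in> {0..}" using coord_nonneg G_bounds[OF u0] by auto
        show "h_branch lam (i - 1) (\<xi> (G u0)) = lam"
          using h_branch_coord[OF u0, of "i - 1"] i_pos lam_coord by (simp add: u0_def of_nat_diff)
      qed
      then have dom: "branch_domain lam i = {0..<\<xi> (G u0)}"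
        using m True i by (simp add: branch_domain_def last_domain_def)
      show ?thesis unfolding dom
      proof (intro equalityI subsetI)
        fix y assume y: "y \<in> {0..<\<xi> (G u0)}"
        then obtain u where u: "0 \<le> u" "u < 1" "y = \<xi> (G u)" using G_onto_coord by auto
        then have "u < u0" using y coord_G_less_iff[of u u0] u0 by auto
        then show "y \<in> (\<lambda>u. \<xi> (G u)) ` {u. 0 \<le> u \<and> u < 1 \<and> u + real i < G 1}"
          using u by (intro image_eqI[of _ _ u]) (auto simp: u0_def)
      next
        fix y assume "y \<in> (\<lambda>u. \<xi> (G u)) ` {u. 0 \<le> u \<and> u < 1 \<and> u + real i < G 1}"
        then obtain u where "0 \<le> u" "u < 1" "u < u0" "y = \<xi> (G u)" by (auto simp: u0_def)
        then show "y \<in> {0..<\<xi> (G u0)}"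
          using coord_G_less_iff[of u u0] u0 coord_nonneg[of "G u"] G_bounds[of u] by auto
      qed
    qed
  qed
qed

lemma T_map_coord:
  assumes v: "v \<in> {0..<G 1}"
  shows "T_map lam (\<xi> v) = \<xi> (floor_map G v)"
proof -
  define k where "k = nat \<lfloor>v\<rfloor>"
  have kv: "frac v + real k = v" using v by (simp add: k_def frac_def)
  have "real k < real (i_top lam) + 1" using kv frac_ge_0[of v] v i_top_bounds(2) by (simp del: frac_ge_0)
  then have k: "k \<le> i_top lam" by linarith
  have u: "0 \<le> frac v" "frac v < 1" by (auto simp: frac_lt_1)
  note dom = branch_domain_coord[OF k]
  have "inv_into (branch_domain lam k) (h_branch lam k) (\<xi> v) = \<xi> (G (frac v))"
  proof (rule inv_into_f_eq)
    show "inj_on (h_branch lam k) (branch_domain lam k)"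
      by (rule inj_on_h_branch) (auto simp: dom)
    show "\<xi> (G (frac v)) \<in> branch_domain lam k"
      unfolding dom using u kv v by (intro image_eqI[of _ _ "frac v"]) auto
    show "h_branch lam k (\<xi> (G (frac v))) = \<xi> v" using h_branch_coord[OF u, of k] kv v by simp
  qed
  then show ?thesis using part_index_coord[OF v] by (simp add: T_map_def k_def floor_map_def)
qed

lemma conjugate_T_S_iff: "conjugate_T_S lam b \<longleftrightarrow> conjugate_floor_map G b"
proof -
  obtain \<zeta> where \<zeta>: "homeomorphism {0..<G 1} {0..} \<xi> \<zeta>" using coord_homeomorphism by auto
  have \<zeta>\<xi>: "\<zeta> (\<xi> v) = v" if "v \<in> {0..<G 1}" for v using homeomorphism_apply1[OF \<zeta> that] .
  show ?thesis
  proof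
    assume "conjugate_T_S lam b"
    then obtain \<phi> \<psi> where \<phi>: "homeomorphism {0..} {0..<1} \<phi> \<psi>"
      and eq: "\<And>x. 0 \<le> x \<Longrightarrow> \<phi> (T_map lam x) = S_map b (\<phi> x)"
      by (auto simp: conjugate_T_S_def)
    have "\<forall>v\<in>{0..<G 1}. (\<phi> \<circ> \<xi>) (floor_map G v) = S_map b ((\<phi> \<circ> \<xi>) v)"
    proof
      fix v assume v: "v \<in> {0..<G 1}"
      show "(\<phi> \<circ> \<xi>) (floor_map G v) = S_map b ((\<phi> \<circ> \<xi>) v)"
        using eq[OF coord_nonneg[OF v]] T_map_coord[OF v] by simp
    qed
    with homeomorphism_compose[OF \<zeta> \<phi>] show "conjugate_floor_map G b"
      unfolding conjugate_floor_map_def by (intro exI conjI)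
  next
    assume "conjugate_floor_map G b"
    then obtain \<phi> \<psi> where \<phi>: "homeomorphism {0..<G 1} {0..<1} \<phi> \<psi>"
      and eq: "\<And>v. v \<in> {0..<G 1} \<Longrightarrow> \<phi> (floor_map G v) = S_map b (\<phi> v)"
      by (auto simp: conjugate_floor_map_def)
    have "(\<phi> \<circ> \<zeta>) (T_map lam x) = S_map b ((\<phi> \<circ> \<zeta>) x)" if "x \<in> {0..}" for x
    proof -
      have "x \<in> \<xi> ` {0..<G 1}" using coord_onto that by simp
      then obtain v where v: "v \<in> {0..<G 1}" "x = \<xi> v" by blast
      then show ?thesis using eq[OF v(1)] T_map_coord[OF v(1)] \<zeta>\<xi>[OF v(1)] \<zeta>\<xi>[OF tau_in, of v] by simp
    qed
    then have "\<forall>x\<in>{0..}. (\<phi> \<circ> \<zeta>) (T_map lam x) = S_map b ((\<phi> \<circ> \<zeta>) x)" by simp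
    with homeomorphism_compose[OF homeomorphism_symD[OF \<zeta>] \<phi>] show "conjugate_T_S lam b"
      unfolding conjugate_T_S_def by (intro exI conjI)
  qed
qed

lemma beta_props: "1 < beta lam" "digit_sup G (beta lam) = 1"
proof -
  have "\<exists>!b. 1 < b \<and> conjugate_T_S lam b" unfolding conjugate_T_S_iff by (rule conjugate_ex1)
  then have "1 < beta lam \<and> conjugate_T_S lam (beta lam)" unfolding beta_def by (rule theI')
  then show "1 < beta lam" "digit_sup G (beta lam) = 1"
    using conjugate_iff by (auto simp: conjugate_T_S_iff)
qed

end

section \<open>Dependence of the base on the parameter\<close>

lemma hecke_angle_arccos:
  assumes "lam \<in> {0<..<2}"
  shows "hecke_angle (arccos (lam / 2)) lam"
proof
  show "0 < arccos (lam / 2)" using arccos_less_arccos[of "lam / 2" 1] assms by simp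
  show "arccos (lam / 2) < pi / 2" using arccos_less_arccos[of 0 "lam / 2"] assms by simp
  show "lam = 2 * cos (arccos (lam / 2))" using assms by simp
qed

lemma hecke_angle_lam: "hecke_angle \<theta> lam \<Longrightarrow> lam \<in> {0<..<2}"
  using cos_gt_zero[of \<theta>] cos_monotone_0_pi[of 0 \<theta>]
  by (auto simp: hecke_angle_def)

lemma beta_strict_antimono_angle:
  assumes "hecke_angle \<theta> lam" "hecke_angle \<alpha> mu" "\<alpha> < \<theta>"
  shows "beta lam < beta mu"
proof -
  interpret A: hecke_angle \<theta> lam by fact
  interpret B: hecke_angle \<alpha> mu by fact
  show ?thesis
  proof (rule sup_1_strict_mono[OF A.expanding_branch_axioms B.expanding_branch_axioms])
    show "angle_branch \<theta> u \<le> angle_branch \<alpha> u" if "u \<in> {0..<1}" for u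
      using angle_branch_compare(1)[OF A.\<theta>_pos A.\<theta>_less B.\<theta>_pos, of u] assms(3) that
      by (cases "u = 0") (auto simp: angle_branch_def[of _ 0])
    show "angle_branch \<theta> 1 < angle_branch \<alpha> 1"
      using assms(3) A.\<theta>_pos B.\<theta>_pos by (simp add: A.G_1 B.G_1 frac_less2)
  qed (rule A.beta_props B.beta_props)+
qed

lemma beta_strict_mono: "strict_mono_on {0<..<2} beta"
proof (rule strict_mono_onI)
  fix r s :: real assume "r \<in> {0<..<2}" "s \<in> {0<..<2}" "r < s"
  then show "beta r < beta s"
    using arccos_less_arccos[of "r / 2" "s / 2"]
      beta_strict_antimono_angle[OF hecke_angle_arccos hecke_angle_arccos, of r s] by simp
qed

lemma beta_continuous: "continuous_on {0<..<2} beta"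
  unfolding continuous_on_iff
proof (intro ballI allI impI)
  fix lam e :: real assume lam: "lam \<in> {0<..<2}" and e: "0 < e"
  define \<theta> where "\<theta> = arccos (lam / 2)"
  interpret A: hecke_angle \<theta> lam unfolding \<theta>_def using lam by (rule hecke_angle_arccos)
  have "0 < e / 2" using e by simp
  then obtain d1 where d1: "0 < d1" "\<And>H c. expanding_branch H \<Longrightarrow>
      (\<And>u. u \<in> {0..1} \<Longrightarrow> \<bar>H u - angle_branch \<theta> u\<bar> \<le> d1) \<Longrightarrow>
      1 < c \<Longrightarrow> digit_sup H c = 1 \<Longrightarrow> \<bar>c - beta lam\<bar> \<le> e / 2"
    using A.sup_1_stable[OF A.beta_props] by metis
  obtain d2 where d2: "0 < d2" "\<And>\<alpha> u. 0 < \<alpha> \<Longrightarrow> \<alpha> < pi / 2 \<Longrightarrow> \<bar>\<alpha> - \<theta>\<bar> < d2 \<Longrightarrow> u \<in> {0..1} \<Longrightarrow>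
      \<bar>angle_branch \<alpha> u - angle_branch \<theta> u\<bar> \<le> d1"
    using angle_branch_uniform[OF A.\<theta>_pos A.\<theta>_less d1(1)] by metis
  have "continuous_on {0<..<2} (\<lambda>mu. arccos (mu / 2))"
    by (intro continuous_intros) auto
  then obtain d where d: "0 < d" "\<And>mu. mu \<in> {0<..<2} \<Longrightarrow> dist mu lam < d \<Longrightarrow> \<bar>arccos (mu / 2) - \<theta>\<bar> < d2"
    using lam d2(1) unfolding continuous_on_iff \<theta>_def dist_real_def by metis
  show "\<exists>d>0. \<forall>mu\<in>{0<..<2}. dist mu lam < d \<longrightarrow> dist (beta mu) (beta lam) < e"
  proof (intro exI[of _ d] conjI ballI impI)
    fix mu :: real assume mu: "mu \<in> {0<..<2}" "dist mu lam < d"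
    interpret B: hecke_angle "arccos (mu / 2)" mu using mu(1) by (rule hecke_angle_arccos)
    have "\<bar>beta mu - beta lam\<bar> \<le> e / 2"
      using d1(2)[OF B.expanding_branch_axioms d2(2)[OF B.\<theta>_pos B.\<theta>_less d(2)[OF mu]] B.beta_props] .
    then show "dist (beta mu) (beta lam) < e" using e by (simp add: dist_real_def)
  qed (rule d(1))
qed

text \<open>For \<open>t\<close> near \<open>pi / 2\<close> the branch is within \<open>2 cot t / t\<close> of the identity and its domain ends just
beyond \<open>1\<close>, so \<open>sup_1_less\<close> applies to every \<open>c > 1\<close>.\<close>

lemma beta_small:
  assumes c: "1 < c"
  shows "\<exists>lam\<in>{0<..<2}. beta lam < c"
proof -
  let ?f = "\<lambda>t. pi / t - 1 + (2 * cot t / t) / (c - 1)"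
  have "isCont ?f (pi / 2)" using c by (intro continuous_intros) auto
  then have "(?f \<longlongrightarrow> ?f (pi / 2)) (at_left (pi / 2))"
    unfolding isCont_def by (rule tendsto_within_subset) auto
  moreover have "?f (pi / 2) < c" using c by (simp add: cot_def)
  ultimately have "\<forall>\<^sub>F t in at_left (pi / 2). ?f t < c" by (rule order_tendstoD(2))
  then have "\<forall>\<^sub>F t in at_left (pi / 2). ?f t < c \<and> t \<in> {0<..<pi / 2}"
    using eventually_at_left_real[of 0 "pi / 2"] by (auto intro: eventually_conj)
  from eventually_happens'[OF trivial_limit_at_left_real this]
  obtain t where t: "?f t < c" "0 < t" "t < pi / 2" by auto
  interpret hecke_angle t "2 * cos t" using t by unfold_locales auto
  have "beta (2 * cos t) < c"
  proof (rule sup_1_less[OF beta_props c])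
    show "angle_branch t u \<le> u + 2 * cot t / t" if "u \<in> {0..<1}" for u
      using angle_branch_near_id[OF t(2,3)] that by auto
    show "angle_branch t 1 + 2 * cot t / t / (c - 1) < c" using t(1) by (simp add: G_1)
    show "0 \<le> 2 * cot t / t" using cot_gt_zero[OF t(2,3)] t by simp
  qed
  then show ?thesis using hecke_angle_lam[OF hecke_angle_axioms] by blast
qed

text \<open>An integer \<open>k\<close> in the domain of the floor map goes to \<open>k / b < 1\<close> under the conjugacy. With
\<open>t = pi / (k + 3)\<close> the domain ends at \<open>k + 2\<close>.\<close>

lemma beta_large: "\<exists>lam\<in>{0<..<2}. c \<le> beta lam"
proof -
  define k where "k = nat \<lceil>c\<rceil>"
  define t where "t = pi / (real k + 3)"
  have t: "0 < t" "t < pi / 2" by (auto simp: t_def field_simps add_pos_nonneg)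
  interpret hecke_angle t "2 * cos t" using t by unfold_locales auto
  have "angle_branch t 1 = real k + 2" using G_1 by (simp add: t_def)
  then have "of_int (int k) \<le> beta (2 * cos t)"
    by (intro sup_1_ge_int[OF beta_props]) auto
  moreover have "c \<le> of_int (int k)" unfolding k_def by linarith
  ultimately have "c \<le> beta (2 * cos t)" by linarith
  then show ?thesis using hecke_angle_lam[OF hecke_angle_axioms] by blast
qed

lemma beta_onto: "beta ` {0<..<2} = {1<..}"
proof (intro equalityI subsetI)
  fix b assume "b \<in> beta ` {0<..<2}"
  then show "b \<in> {1<..}" using hecke_angle.beta_props(1)[OF hecke_angle_arccos] by auto
next
  fix b :: real assume "b \<in> {1<..}"
  then obtain lam where lam: "lam \<in> {0<..<2}" "beta lam < b" using beta_small[of b] by auto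
  obtain mu where mu: "mu \<in> {0<..<2}" "b \<le> beta mu" using beta_large by blast
  have "lam \<le> mu"
    using strict_mono_onD[OF beta_strict_mono mu(1) lam(1)] lam(2) mu(2) by (cases "lam \<le> mu") auto
  moreover have "continuous_on {lam..mu} beta"
    using lam mu by (intro continuous_on_subset[OF beta_continuous]) auto
  ultimately obtain x where "lam \<le> x" "x \<le> mu" "beta x = b"
    using IVT'[of beta lam b mu] lam mu by auto
  then show "b \<in> beta ` {0<..<2}" using lam mu by (intro image_eqI[of _ _ x]) auto
qed

theorem theorem4p8:
  shows "strict_mono_on {0<..<2} beta \<and> continuous_on {0<..<2} beta \<and> beta ` {0<..<2} = {1<..}"
  using beta_strict_mono beta_continuous beta_onto by blast

end
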